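(* Let $A$ be a graded superring, $B$ a graded subring, $\alpha$ an automorphism of $A$, $\beta$ an automorphism of $B$, $\lambda\in\Lambda$, $\pi\in\mathbb{Z}_2$. Assume that $A$ is finitely generated and projective as a right $B$-module. Then $A$ is an $(\alpha,\beta)$-Frobenius extension of $B$ of degree $(-\lambda,\pi)$ if and only if there exists a homomorphism of $(B,B)$-bimodules $\mathrm{tr}^{\mathrm R}\colon{}^{\alpha^{-1}}_{B}A^{\beta^{-1}}_{B}\to\{\lambda,\pi\}{}_BB_B$ satisfying: (R3) if $\mathrm{tr}^{\mathrm R}(aA)=0$ for some $a\in A$, then $a=0$; (R4) for every $\varphi\in\mathrm{HOM}^{\mathrm R}_B(A^{\beta^{-1}}_{B},B_B)$ there exists an $a\in A$ such that $\varphi=\mathrm{tr}^{\mathrm R}\circ{}^{\ell}a$ (equality of maps of underlying abelian groups $A\to B$).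
   Context: Fix an abelian group $\Lambda$. A graded superring is an associative unital $\Lambda\times\mathbb{Z}_2$-graded ring; subrings are graded (with the same unit), automorphisms preserve the grading, and modules and bimodules are $\Lambda\times\mathbb{Z}_2$-graded. For homogeneous $v$, $|v|\in\Lambda$ and $\bar v\in\mathbb{Z}_2$ denote its degrees; formulas involving degrees are stated for homogeneous elements and extended additively. Homomorphisms of modules and bimodules are additive maps of degree $(0,0)$ commuting strictly with the actions. Shifts: $\{\mu,\gamma\}M$ is $M$ as an abelian group, with $(\{\mu,\gamma\}M)_{\nu,\delta}=M_{\nu-\mu,\delta+\gamma}$, unchanged right action, and left action $a\cdot\{\mu,\gamma\}m=(-1)^{\gamma\bar a}\{\mu,\gamma\}(am)$. Twists: ${}^{\beta}_{B}A^{\alpha}_{A}$ is $A$ as a graded abelian group with $b\cdot x=\beta(b)x$ and $x\cdot a=x\alpha(a)$. ${}^{\alpha^{-1}}_{A}A^{\beta^{-1}}_{B}$ is $A$ with $a\cdot x=\alpha^{-1}(a)x$ and $x\cdot b=x\beta^{-1}(b)$; ${}^{\alpha^{-1}}_{B}A^{\beta^{-1}}_{B}$ and $A^{\beta^{-1}}_{B}$ are obtained by restricting, resp. forgetting, its left action. For $a\in A$, ${}^{\ell}a\colon A\to A$ is ${}^{\ell}a(x)=ax$ (ordinary multiplication in $A$). For a right $B$-module $N$, $\mathrm{HOM}^{\mathrm R}_B(A^{\beta^{-1}}_{B},N)$ is the direct sum over $(\mu,\gamma)\in\Lambda\times\mathbb{Z}_2$ of the groups of additive maps $f\colon A\to N$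 of degree $(\mu,\gamma)$ with $f(x\beta^{-1}(b))=f(x)b$. $\mathrm{HOM}^{\mathrm R}_B({}^{\alpha^{-1}}_{A}A^{\beta^{-1}}_{B},\{\lambda,\pi\}{}_BB_B)$ is a $(B,A)$-bimodule via $(b\cdot f)(x)=b\cdot f(x)$ (left action in $\{\lambda,\pi\}B$) and $(f\cdot a)(x)=f(\alpha^{-1}(a)x)$. $\mathrm{HOM}^{\mathrm L}_B({}^{\beta}_{B}A^{\alpha}_{A},\{\lambda,\pi\}{}_BB_B)$ is the direct sum over $(\mu,\gamma)$ of the groups of additive maps $f\colon A\to\{\lambda,\pi\}B$ of degree $(\mu,\gamma)$ with $f(\beta(b)x)=(-1)^{\gamma\bar b}\,b\cdot f(x)$ (action in $\{\lambda,\pi\}B$), an $(A,B)$-bimodule via $(a\cdot f)(x)=(-1)^{\bar a\bar f+\bar a\bar x}f(x\alpha(a))$ and $(f\cdot b)(x)=(-1)^{\bar b\bar x}f(x)b$. $A$ is an $(\alpha,\beta)$-Frobenius extension of $B$ of degree $(-\lambda,\pi)$ if (L1) $A$ is finitely generated and projective as a left $B$-module and (L2) ${}_AA_B\cong\mathrm{HOM}^{\mathrm L}_B({}^{\beta}_{B}A^{\alpha}_{A},\{\lambda,\pi\}{}_BB_B)$ as $(A,B)$-bimodules; equivalently (a fact established separately), if (R1) $A$ is finitely generated and projective as a right $B$-module and (R2) ${}_BA_A\cong\mathrm{HOM}^{\mathrm R}_B({}^{\alpha^{-1}}_{A}A^{\beta^{-1}}_{B},\{\lambda,\pi\}{}_BB_B)$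 as $(B,A)$-bimodules. *)

theory Defs
  imports Main "HOL-Library.Z2" "HOL-Library.Product_Plus" "HOL-Library.Function_Algebras"
begin

text \<open>
  Conventions.

  \<^item> Degrees are elements of \<open>'l \<times> bit\<close>, where \<open>'l\<close> is the grading group \<open>\<Lambda>\<close> and \<open>bit\<close> is the
    field with two elements.

  \<^item> A graded abelian group is given by the family of its homogeneous components, which are
    subgroups of an ambient abelian group with independent sum; \<open>dsum M\<close> is the group itself.
    Only the values of maps and actions on \<open>dsum M\<close> matter.

  \<^item> Every action, left or right, takes the scalar first: for a right action \<open>r\<close>,
    \<open>r b x\<close> stands for \<open>x \<cdot> b\<close>.

  \<^item> Rings have the sort \<open>{ring, monoid_mult}\<close> rather than \<open>ring_1\<close>: the zero ring is not excluded.
\<close>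

section \<open>Graded abelian groups\<close>

definition add_subgroup :: "'m::ab_group_add set \<Rightarrow> bool" where
  "add_subgroup S \<longleftrightarrow> 0 \<in> S \<and> (\<forall>x\<in>S. \<forall>y\<in>S. x + y \<in> S) \<and> (\<forall>x\<in>S. - x \<in> S)"

definition dsum :: "('d \<Rightarrow> 'm::ab_group_add set) \<Rightarrow> 'm set" where
  "dsum M = {\<Sum>d\<in>D. c d | D c. finite D \<and> (\<forall>d\<in>D. c d \<in> M d)}"

definition graded_group :: "('d \<Rightarrow> 'm::ab_group_add set) \<Rightarrow> bool" where
  "graded_group M \<longleftrightarrow> (\<forall>d. add_subgroup (M d)) \<and>
     (\<forall>D c. finite D \<longrightarrow> (\<forall>d\<in>D. c d \<in> M d) \<longrightarrow> (\<Sum>d\<in>D. c d) = 0 \<longrightarrow> (\<forall>d\<in>D. c d = 0))"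

definition additive_on :: "'m::ab_group_add set \<Rightarrow> ('m \<Rightarrow> 'n::ab_group_add) \<Rightarrow> bool" where
  "additive_on S f \<longleftrightarrow> (\<forall>x\<in>S. \<forall>y\<in>S. f (x + y) = f x + f y)"

definition hcomp :: "('d \<Rightarrow> 'm::ab_group_add set) \<Rightarrow> 'm \<Rightarrow> 'd \<Rightarrow> 'm" where
  "hcomp M x =
     (THE c. (\<forall>d. c d \<in> M d) \<and> finite {d. c d \<noteq> 0} \<and> (\<Sum>d | c d \<noteq> 0. c d) = x)"

text \<open>
  \<open>hext M F\<close> is the additive extension of a map given on homogeneous elements; \<open>F d\<close> is its
  value on elements of degree \<open>d\<close>. It renders formulas that involve degrees.
\<close>

definition hext ::
  "('d \<Rightarrow> 'm::ab_group_add set) \<Rightarrow> ('d \<Rightarrow> 'm \<Rightarrow> 'n::ab_group_add) \<Rightarrow> 'm \<Rightarrow> 'n" where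
  "hext M F x = (\<Sum>d | hcomp M x d \<noteq> 0. F d (hcomp M x d))"

text \<open>\<open>koszul p x\<close> is \<open>(-1)\<^sup>p x\<close>.\<close>

definition koszul :: "bit \<Rightarrow> 'm::ab_group_add \<Rightarrow> 'm" where
  "koszul p x = (if p = 0 then x else - x)"

section \<open>Graded superrings\<close>

definition graded_ring :: "('d::ab_group_add \<Rightarrow> 'r::{ring,monoid_mult} set) \<Rightarrow> bool" where
  "graded_ring R \<longleftrightarrow> graded_group R \<and> 1 \<in> R 0 \<and>
     (\<forall>d e. \<forall>x\<in>R d. \<forall>y\<in>R e. x * y \<in> R (d + e))"

definition graded_superring ::
  "('l::ab_group_add \<times> bit \<Rightarrow> 'a::{ring,monoid_mult} set) \<Rightarrow> bool" where
  "graded_superring A \<longleftrightarrow> graded_ring A \<and> dsum A = UNIV"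

definition graded_subring ::
  "('l::ab_group_add \<times> bit \<Rightarrow> 'a::{ring,monoid_mult} set) \<Rightarrow> ('l \<times> bit \<Rightarrow> 'a set) \<Rightarrow> bool" where
  "graded_subring B A \<longleftrightarrow> graded_ring B \<and> (\<forall>d. B d \<subseteq> A d)"

definition graded_automorphism ::
  "('d \<Rightarrow> 'r::{ring,monoid_mult} set) \<Rightarrow> ('r \<Rightarrow> 'r) \<Rightarrow> bool" where
  "graded_automorphism R \<sigma> \<longleftrightarrow> bij_betw \<sigma> (dsum R) (dsum R) \<and> additive_on (dsum R) \<sigma> \<and>
     (\<forall>x\<in>dsum R. \<forall>y\<in>dsum R. \<sigma> (x * y) = \<sigma> x * \<sigma> y) \<and> \<sigma> 1 = 1 \<and> (\<forall>d. \<sigma> ` R d = R d)"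

definition aut_inv :: "('d \<Rightarrow> 'r::{ring,monoid_mult} set) \<Rightarrow> ('r \<Rightarrow> 'r) \<Rightarrow> 'r \<Rightarrow> 'r" where
  "aut_inv R \<sigma> = inv_into (dsum R) \<sigma>"

section \<open>Graded modules and bimodules\<close>

text \<open>
  The parameter \<open>mul\<close> is the multiplication of \<open>R\<close> for left modules and the opposite
  multiplication for right modules.
\<close>

definition graded_module ::
  "('r \<Rightarrow> 'r \<Rightarrow> 'r) \<Rightarrow> ('d::ab_group_add \<Rightarrow> 'r::{ring,monoid_mult} set) \<Rightarrow>
   ('d \<Rightarrow> 'm::ab_group_add set) \<Rightarrow> ('r \<Rightarrow> 'm \<Rightarrow> 'm) \<Rightarrow> bool" where
  "graded_module mul R M act \<longleftrightarrow> graded_group M \<and>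
     (\<forall>d e. \<forall>r\<in>R d. \<forall>m\<in>M e. act r m \<in> M (d + e)) \<and>
     (\<forall>r\<in>dsum R. additive_on (dsum M) (act r)) \<and>
     (\<forall>m\<in>dsum M. additive_on (dsum R) (\<lambda>r. act r m)) \<and>
     (\<forall>m\<in>dsum M. act 1 m = m) \<and>
     (\<forall>r\<in>dsum R. \<forall>s\<in>dsum R. \<forall>m\<in>dsum M. act (mul r s) m = act r (act s m))"

abbreviation "graded_left_module \<equiv> graded_module (*)"
abbreviation "graded_right_module \<equiv> graded_module (\<lambda>r s. s * r)"

definition module_hom ::
  "('d \<Rightarrow> 'r::{ring,monoid_mult} set) \<Rightarrow>
   ('d \<Rightarrow> 'm::ab_group_add set) \<Rightarrow> ('r \<Rightarrow> 'm \<Rightarrow> 'm) \<Rightarrow>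
   ('d \<Rightarrow> 'n::ab_group_add set) \<Rightarrow> ('r \<Rightarrow> 'n \<Rightarrow> 'n) \<Rightarrow> ('m \<Rightarrow> 'n) \<Rightarrow> bool" where
  "module_hom R M actM N actN f \<longleftrightarrow> additive_on (dsum M) f \<and> (\<forall>d. f ` M d \<subseteq> N d) \<and>
     (\<forall>r\<in>dsum R. \<forall>m\<in>dsum M. f (actM r m) = actN r (f m))"

definition bimodule_hom ::
  "('d \<Rightarrow> 'r::{ring,monoid_mult} set) \<Rightarrow> ('d \<Rightarrow> 's::{ring,monoid_mult} set) \<Rightarrow>
   ('d \<Rightarrow> 'm::ab_group_add set) \<Rightarrow> ('r \<Rightarrow> 'm \<Rightarrow> 'm) \<Rightarrow> ('s \<Rightarrow> 'm \<Rightarrow> 'm) \<Rightarrow>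
   ('d \<Rightarrow> 'n::ab_group_add set) \<Rightarrow> ('r \<Rightarrow> 'n \<Rightarrow> 'n) \<Rightarrow> ('s \<Rightarrow> 'n \<Rightarrow> 'n) \<Rightarrow> ('m \<Rightarrow> 'n) \<Rightarrow> bool" where
  "bimodule_hom R S M lM rM N lN rN f \<longleftrightarrow>
     module_hom R M lM N lN f \<and> module_hom S M rM N rN f"

definition bimodule_isomorphic ::
  "('d \<Rightarrow> 'r::{ring,monoid_mult} set) \<Rightarrow> ('d \<Rightarrow> 's::{ring,monoid_mult} set) \<Rightarrow>
   ('d \<Rightarrow> 'm::ab_group_add set) \<Rightarrow> ('r \<Rightarrow> 'm \<Rightarrow> 'm) \<Rightarrow> ('s \<Rightarrow> 'm \<Rightarrow> 'm) \<Rightarrow>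
   ('d \<Rightarrow> 'n::ab_group_add set) \<Rightarrow> ('r \<Rightarrow> 'n \<Rightarrow> 'n) \<Rightarrow> ('s \<Rightarrow> 'n \<Rightarrow> 'n) \<Rightarrow> bool" where
  "bimodule_isomorphic R S M lM rM N lN rN \<longleftrightarrow>
     (\<exists>f. bimodule_hom R S M lM rM N lN rN f \<and> bij_betw f (dsum M) (dsum N))"

definition finitely_generated ::
  "('d \<Rightarrow> 'r::{ring,monoid_mult} set) \<Rightarrow> ('d \<Rightarrow> 'm::ab_group_add set) \<Rightarrow>
   ('r \<Rightarrow> 'm \<Rightarrow> 'm) \<Rightarrow> bool" where
  "finitely_generated R M act \<longleftrightarrow>
     (\<exists>S. finite S \<and> S \<subseteq> dsum M \<and>
        (\<forall>m\<in>dsum M. \<exists>c. (\<forall>s\<in>S. c s \<in> dsum R) \<and> m = (\<Sum>s\<in>S. act (c s) s)))"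

text \<open>
  Projectivity: homomorphisms out of \<open>P\<close> lift along surjections \<open>g : X \<rightarrow> Y\<close> of graded modules. A
  definition cannot quantify over the types carrying \<open>X\<close> and \<open>Y\<close>. The ambient groups chosen here
  are large enough: the free module on the homogeneous elements of \<open>P\<close> lives in \<open>'m \<Rightarrow> 'r\<close>, so
  that \<open>P\<close> is a retract of it. Lemma \<open>projective_lift\<close> below derives the lifting property for
  \<open>X\<close> and \<open>Y\<close> of arbitrary types.
\<close>

definition projective ::
  "('r \<Rightarrow> 'r \<Rightarrow> 'r) \<Rightarrow> ('d::ab_group_add \<Rightarrow> 'r::{ring,monoid_mult} set) \<Rightarrow>
   ('d \<Rightarrow> 'm::ab_group_add set) \<Rightarrow> ('r \<Rightarrow> 'm \<Rightarrow> 'm) \<Rightarrow> bool" where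
  "projective mul R P act \<longleftrightarrow>
     (\<forall>(X :: 'd \<Rightarrow> ('m \<Rightarrow> 'r) set) actX (Y :: 'd \<Rightarrow> 'm set) actY g f.
        graded_module mul R X actX \<and> graded_module mul R Y actY \<and>
        module_hom R X actX Y actY g \<and> g ` dsum X = dsum Y \<and> module_hom R P act Y actY f \<longrightarrow>
        (\<exists>h. module_hom R P act X actX h \<and> (\<forall>p\<in>dsum P. g (h p) = f p)))"

abbreviation "left_projective \<equiv> projective (*)"
abbreviation "right_projective \<equiv> projective (\<lambda>r s. s * r)"

section \<open>Shifts and groups of homomorphisms\<close>

text \<open>
  The shift \<open>{\<mu>,\<gamma>}M\<close> for \<open>s = (\<mu>, \<gamma>)\<close> has the grading \<open>shift s M\<close>, the left action
  \<open>shift_lact s R act\<close> and the same right action as \<open>M\<close>.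
\<close>

definition shift ::
  "'l::ab_group_add \<times> bit \<Rightarrow> ('l \<times> bit \<Rightarrow> 'm set) \<Rightarrow> 'l \<times> bit \<Rightarrow> 'm set" where
  "shift s M = (\<lambda>(\<nu>, \<delta>). M (\<nu> - fst s, \<delta> + snd s))"

definition shift_lact ::
  "'l::ab_group_add \<times> bit \<Rightarrow> ('l \<times> bit \<Rightarrow> 'r::{ring,monoid_mult} set) \<Rightarrow>
   ('r \<Rightarrow> 'm::ab_group_add \<Rightarrow> 'm) \<Rightarrow> 'r \<Rightarrow> 'm \<Rightarrow> 'm" where
  "shift_lact s R act a m = hext R (\<lambda>d a'. koszul (snd s * snd d) (act a' m)) a"

text \<open>
  \<open>HOM_R\<close> and \<open>HOM_L\<close> are given by their homogeneous components, so that \<open>dsum\<close> of them is the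
  direct sum over all degrees. Maps vanish outside \<open>dsum M\<close> in order to make functions represent
  maps \<open>M \<rightarrow> N\<close> uniquely.
\<close>

definition HOM_R ::
  "('l::ab_group_add \<times> bit \<Rightarrow> 'r::{ring,monoid_mult} set) \<Rightarrow>
   ('l \<times> bit \<Rightarrow> 'm::ab_group_add set) \<Rightarrow> ('r \<Rightarrow> 'm \<Rightarrow> 'm) \<Rightarrow>
   ('l \<times> bit \<Rightarrow> 'n::ab_group_add set) \<Rightarrow> ('r \<Rightarrow> 'n \<Rightarrow> 'n) \<Rightarrow> 'l \<times> bit \<Rightarrow> ('m \<Rightarrow> 'n) set" where
  "HOM_R R M rM N rN d =
     {f. additive_on (dsum M) f \<and> (\<forall>x. x \<notin> dsum M \<longrightarrow> f x = 0) \<and>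
         (\<forall>e. f ` M e \<subseteq> N (e + d)) \<and>
         (\<forall>b\<in>dsum R. \<forall>x\<in>dsum M. f (rM b x) = rN b (f x))}"

definition HOM_L ::
  "('l::ab_group_add \<times> bit \<Rightarrow> 'r::{ring,monoid_mult} set) \<Rightarrow>
   ('l \<times> bit \<Rightarrow> 'm::ab_group_add set) \<Rightarrow> ('r \<Rightarrow> 'm \<Rightarrow> 'm) \<Rightarrow>
   ('l \<times> bit \<Rightarrow> 'n::ab_group_add set) \<Rightarrow> ('r \<Rightarrow> 'n \<Rightarrow> 'n) \<Rightarrow> 'l \<times> bit \<Rightarrow> ('m \<Rightarrow> 'n) set" where
  "HOM_L R M lM N lN d =
     {f. additive_on (dsum M) f \<and> (\<forall>x. x \<notin> dsum M \<longrightarrow> f x = 0) \<and>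
         (\<forall>e. f ` M e \<subseteq> N (e + d)) \<and>
         (\<forall>e. \<forall>b\<in>R e. \<forall>x\<in>dsum M. f (lM b x) = koszul (snd d * snd e) (lN b (f x)))}"

text \<open>
  For an \<open>(R,S)\<close>-bimodule \<open>M\<close> with right action \<open>rM\<close> and an \<open>(R,T)\<close>-bimodule \<open>N\<close> with right action
  \<open>rN\<close>, these are the left \<open>S\<close>-action and the right \<open>T\<close>-action on \<open>H = HOM_L R M \<dots> N \<dots>\<close>.
\<close>

definition HOM_L_lact ::
  "('l::ab_group_add \<times> bit \<Rightarrow> 's::{ring,monoid_mult} set) \<Rightarrow>
   ('l \<times> bit \<Rightarrow> 'm::ab_group_add set) \<Rightarrow> ('s \<Rightarrow> 'm \<Rightarrow> 'm) \<Rightarrow>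
   ('l \<times> bit \<Rightarrow> ('m \<Rightarrow> 'n::ab_group_add) set) \<Rightarrow> 's \<Rightarrow> ('m \<Rightarrow> 'n) \<Rightarrow> 'm \<Rightarrow> 'n" where
  "HOM_L_lact S M rM H a f x =
     hext S (\<lambda>i a'. hext H (\<lambda>j f'. hext M (\<lambda>k x'.
       koszul (snd i * snd j + snd i * snd k) (f' (rM a' x'))) x) f) a"

definition HOM_L_ract ::
  "('l::ab_group_add \<times> bit \<Rightarrow> 't::{ring,monoid_mult} set) \<Rightarrow>
   ('l \<times> bit \<Rightarrow> 'm::ab_group_add set) \<Rightarrow> ('t \<Rightarrow> 'n::ab_group_add \<Rightarrow> 'n) \<Rightarrow>
   't \<Rightarrow> ('m \<Rightarrow> 'n) \<Rightarrow> 'm \<Rightarrow> 'n" where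
  "HOM_L_ract T M rN b f x =
     hext T (\<lambda>i b'. hext M (\<lambda>k x'. koszul (snd i * snd k) (rN b' (f x'))) x) b"

section \<open>Twisted Frobenius extensions\<close>

text \<open>
  The definition in terms of left modules. If the degree \<open>\<delta>\<close> of the extension is \<open>(- \<lambda>, \<pi>)\<close>, then \<open>s = (\<lambda>, \<pi>)\<close>.
\<close>

definition frobenius_extension ::
  "('l::ab_group_add \<times> bit \<Rightarrow> 'a::{ring,monoid_mult} set) \<Rightarrow> ('l \<times> bit \<Rightarrow> 'a set) \<Rightarrow>
   ('a \<Rightarrow> 'a) \<Rightarrow> ('a \<Rightarrow> 'a) \<Rightarrow> 'l \<times> bit \<Rightarrow> bool" where
  "frobenius_extension A B \<alpha> \<beta> \<delta> \<longleftrightarrow>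
     (let s = (- fst \<delta>, snd \<delta>);
          H = HOM_L B A (\<lambda>b x. \<beta> b * x) (shift s B) (shift_lact s B (*))
      in finitely_generated B A (*) \<and> left_projective B A (*) \<and>
         bimodule_isomorphic A B
           A (*) (\<lambda>b x. x * b)
           H (HOM_L_lact A A (\<lambda>a x. x * \<alpha> a) H) (HOM_L_ract B A (\<lambda>b y. y * b)))"

section \<open>Additive extensions and the lifting property\<close>

lemma total_sum:
  assumes "finite D" "\<forall>d\<in>D. c d \<in> M d"
  shows "(\<Sum>d\<in>D. c d) \<in> dsum M"
  using assms unfolding dsum_def by blast

lemma graded_group_zero: "graded_group M \<Longrightarrow> 0 \<in> M d"
  unfolding graded_group_def add_subgroup_def by blast

lemma graded_group_add: "graded_group M \<Longrightarrow> x \<in> M d \<Longrightarrow> y \<in> M d \<Longrightarrow> x + y \<in> M d"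
  unfolding graded_group_def add_subgroup_def by blast

lemma graded_group_minus: "graded_group M \<Longrightarrow> x \<in> M d \<Longrightarrow> - x \<in> M d"
  unfolding graded_group_def add_subgroup_def by blast

lemma graded_group_indep:
  "graded_group M \<Longrightarrow> finite D \<Longrightarrow> (\<And>d. d \<in> D \<Longrightarrow> c d \<in> M d) \<Longrightarrow> (\<Sum>d\<in>D. c d) = 0 \<Longrightarrow>
   d \<in> D \<Longrightarrow> c d = 0"
  unfolding graded_group_def by blast

lemma homogeneous_total: "x \<in> M d \<Longrightarrow> x \<in> dsum M"
  using total_sum[of "{d}" "\<lambda>_. x" M] by simp

lemma total_decomp:
  assumes "graded_group M" "x \<in> dsum M"
  obtains D c where "finite D" "\<And>d. c d \<in> M d" "\<And>d. d \<notin> D \<Longrightarrow> c d = 0" "x = (\<Sum>d\<in>D. c d)"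
proof -
  obtain D c where D: "finite D" "\<forall>d\<in>D. c d \<in> M d" "x = (\<Sum>d\<in>D. c d)"
    using assms(2) unfolding dsum_def by blast
  show thesis
    by (rule that[of D "\<lambda>d. if d \<in> D then c d else 0"])
      (use D graded_group_zero[OF assms(1)] in auto)
qed

lemma total_zero: "0 \<in> dsum M"
  using total_sum[of "{}" "\<lambda>_. 0" M] by simp

lemma total_add:
  assumes M: "graded_group M" and "x \<in> dsum M" "y \<in> dsum M"
  shows "x + y \<in> dsum M"
proof -
  obtain D c where D: "finite D" "\<And>d. c d \<in> M d" "\<And>d. d \<notin> D \<Longrightarrow> c d = 0" "x = (\<Sum>d\<in>D. c d)"
    using total_decomp[OF M assms(2)] by metis
  obtain E e where E: "finite E" "\<And>d. e d \<in> M d" "\<And>d. d \<notin> E \<Longrightarrow> e d = 0" "y = (\<Sum>d\<in>E. e d)"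
    using total_decomp[OF M assms(3)] by metis
  have "x = (\<Sum>d\<in>D \<union> E. c d)" "y = (\<Sum>d\<in>D \<union> E. e d)"
    using D E by (auto intro!: sum.mono_neutral_left)
  then have "x + y = (\<Sum>d\<in>D \<union> E. c d + e d)" by (simp add: sum.distrib)
  moreover have "(\<Sum>d\<in>D \<union> E. c d + e d) \<in> dsum M"
    using D E by (intro total_sum) (auto intro: graded_group_add[OF M])
  ultimately show ?thesis by simp
qed

lemma total_sum_mem:
  assumes M: "graded_group M" and "\<And>i. i \<in> I \<Longrightarrow> c i \<in> dsum M"
  shows "(\<Sum>i\<in>I. c i) \<in> dsum M"
  using assms(2) by (induction I rule: infinite_finite_induct) (auto simp: total_zero total_add[OF M])

lemma additive_on_zero: "additive_on S f \<Longrightarrow> 0 \<in> S \<Longrightarrow> f 0 = 0"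
  unfolding additive_on_def by (metis add_0 add_cancel_right_right)

lemma additive_on_sum:
  assumes M: "graded_group M" and f: "additive_on (dsum M) f" and c: "\<And>i. i \<in> I \<Longrightarrow> c i \<in> dsum M"
  shows "f (\<Sum>i\<in>I. c i) = (\<Sum>i\<in>I. f (c i))"
  using c
proof (induction I rule: infinite_finite_induct)
  case (insert i I)
  then have "f (c i + (\<Sum>i\<in>I. c i)) = f (c i) + f (\<Sum>i\<in>I. c i)"
    using f total_sum_mem[OF M, of I c] unfolding additive_on_def by blast
  with insert show ?case by simp
qed (use additive_on_zero[OF f total_zero] in auto)

lemma hcomp_unique:
  assumes M: "graded_group M" and "\<And>d. c d \<in> M d" "finite {d. c d \<noteq> 0}" "(\<Sum>d | c d \<noteq> 0. c d) = x"
  shows "hcomp M x = c"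
  unfolding hcomp_def
proof (rule the_equality)
  show "(\<forall>d. c d \<in> M d) \<and> finite {d. c d \<noteq> 0} \<and> (\<Sum>d | c d \<noteq> 0. c d) = x"
    using assms by blast
  fix e assume e: "(\<forall>d. e d \<in> M d) \<and> finite {d. e d \<noteq> 0} \<and> (\<Sum>d | e d \<noteq> 0. e d) = x"
  let ?D = "{d. c d \<noteq> 0} \<union> {d. e d \<noteq> 0}"
  have fin: "finite ?D" using assms e by auto
  have "x = (\<Sum>d\<in>?D. c d)" "x = (\<Sum>d\<in>?D. e d)"
    unfolding assms(4)[symmetric]
     apply (rule sum.mono_neutral_left; use fin in auto)
    unfolding assms(4) using e fin by (auto intro!: sum.mono_neutral_cong_left)
  then have z: "(\<Sum>d\<in>?D. c d - e d) = 0" by (simp add: sum_subtractf)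
  have "c d - e d = 0" if "d \<in> ?D" for d
    by (rule graded_group_indep[OF M fin _ z that])
      (metis assms(2) e graded_group_add[OF M] graded_group_minus[OF M] diff_conv_add_uminus)
  then have "c d = e d" for d by (cases "d \<in> ?D") auto
  then show "e = c" by (simp add: fun_eq_iff)
qed

lemma hcomp_props:
  assumes M: "graded_group M" and x: "x \<in> dsum M"
  shows "hcomp M x d \<in> M d" "finite {d. hcomp M x d \<noteq> 0}" "(\<Sum>d | hcomp M x d \<noteq> 0. hcomp M x d) = x"
proof -
  obtain D c where D: "finite D" "\<And>d. c d \<in> M d" "\<And>d. d \<notin> D \<Longrightarrow> c d = 0" "x = (\<Sum>d\<in>D. c d)"
    using total_decomp[OF M x] by metis
  have sub: "{d. c d \<noteq> 0} \<subseteq> D" using D(3) by blast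
  have fin: "finite {d. c d \<noteq> 0}" by (rule finite_subset[OF sub D(1)])
  have s: "(\<Sum>d | c d \<noteq> 0. c d) = x"
    unfolding D(4) by (rule sum.mono_neutral_left[OF D(1) sub]) auto
  have "hcomp M x = c" by (rule hcomp_unique[OF M D(2) fin s])
  then show "hcomp M x d \<in> M d" "finite {d. hcomp M x d \<noteq> 0}" "(\<Sum>d | hcomp M x d \<noteq> 0. hcomp M x d) = x"
    using D(2) fin s by simp_all
qed

lemma hcomp_homogeneous:
  assumes "graded_group M" "x \<in> M d"
  shows "hcomp M x = (\<lambda>e. if e = d then x else 0)"
proof (rule hcomp_unique[OF assms(1)])
  have s: "{e. (if e = d then x else 0) \<noteq> 0} = (if x = 0 then {} else {d})" by auto
  show "(if e = d then x else 0) \<in> M e" for e using assms graded_group_zero by auto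
  show "finite {e. (if e = d then x else 0) \<noteq> 0}" unfolding s by simp
  show "(\<Sum>e | (if e = d then x else 0) \<noteq> 0. if e = d then x else 0) = x" unfolding s by simp
qed

lemma hext_homogeneous:
  assumes "graded_group M" "x \<in> M d" "F d 0 = 0"
  shows "hext M F x = F d x"
proof -
  have s: "{e. (if e = d then x else 0) \<noteq> 0} = (if x = 0 then {} else {d})" by auto
  show ?thesis unfolding hext_def hcomp_homogeneous[OF assms(1,2)] s using assms(3) by simp
qed

lemma hext_add:
  assumes M: "graded_group M" and F: "\<And>d. additive_on (M d) (F d)"
    and x: "x \<in> dsum M" and y: "y \<in> dsum M"
  shows "hext M F (x + y) = hext M F x + hext M F y"
proof -
  let ?D = "{d. hcomp M x d \<noteq> 0} \<union> {d. hcomp M y d \<noteq> 0}"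
  have F0: "F d 0 = 0" for d by (rule additive_on_zero[OF F graded_group_zero[OF M]])
  have fin: "finite ?D" using hcomp_props[OF M] x y by auto
  let ?c = "\<lambda>d. hcomp M x d + hcomp M y d"
  have sub: "{d. ?c d \<noteq> 0} \<subseteq> ?D" by auto
  have sx: "(\<Sum>d\<in>?D. hcomp M x d) = x"
    by (subst (2) hcomp_props(3)[OF M x, symmetric], rule sum.mono_neutral_right[OF fin]) auto
  have sy: "(\<Sum>d\<in>?D. hcomp M y d) = y"
    by (subst (2) hcomp_props(3)[OF M y, symmetric], rule sum.mono_neutral_right[OF fin]) auto
  have "hcomp M (x + y) = ?c"
  proof (rule hcomp_unique[OF M])
    show "?c d \<in> M d" for d using hcomp_props(1)[OF M] x y graded_group_add[OF M] by blast
    show "finite {d. ?c d \<noteq> 0}" by (rule finite_subset[OF sub fin])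
    have "(\<Sum>d | ?c d \<noteq> 0. ?c d) = (\<Sum>d\<in>?D. ?c d)"
      by (rule sum.mono_neutral_left[OF fin sub]) auto
    then show "(\<Sum>d | ?c d \<noteq> 0. ?c d) = x + y" using sx sy by (simp add: sum.distrib)
  qed
  then have "hext M F (x + y) = (\<Sum>d | ?c d \<noteq> 0. F d (?c d))" unfolding hext_def by simp
  also have "\<dots> = (\<Sum>d\<in>?D. F d (?c d))"
    by (rule sum.mono_neutral_left[OF fin sub]) (use F0 in \<open>auto simp: F0\<close>)
  also have "\<dots> = (\<Sum>d\<in>?D. F d (hcomp M x d) + F d (hcomp M y d))"
    using F hcomp_props(1)[OF M] x y unfolding additive_on_def by (metis (no_types, lifting))
  also have "\<dots> = (\<Sum>d\<in>?D. F d (hcomp M x d)) + (\<Sum>d\<in>?D. F d (hcomp M y d))" by (rule sum.distrib)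
  also have "(\<Sum>d\<in>?D. F d (hcomp M x d)) = hext M F x"
    unfolding hext_def by (rule sum.mono_neutral_right[OF fin]) (auto simp: F0)
  also have "(\<Sum>d\<in>?D. F d (hcomp M y d)) = hext M F y"
    unfolding hext_def by (rule sum.mono_neutral_right[OF fin]) (auto simp: F0)
  finally show ?thesis .
qed

lemma module_hom_homogeneous_preimage:
  assumes X: "graded_module mul R X aX" and Y: "graded_module mul R Y aY"
    and g: "module_hom R X aX Y aY g" "g ` dsum X = dsum Y" and y: "y \<in> Y d"
  shows "\<exists>x\<in>X d. g x = y"
proof -
  have gX: "graded_group X" and gY: "graded_group Y" using X Y unfolding graded_module_def by auto
  have add: "additive_on (dsum X) g" and deg: "\<And>d. g ` X d \<subseteq> Y d"
    using g(1) unfolding module_hom_def by auto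
  obtain x where x: "x \<in> dsum X" "g x = y" using g(2) homogeneous_total[of y Y d, OF y] by (metis imageE)
  obtain D c where D: "finite D" "\<And>d. c d \<in> X d" "\<And>d. d \<notin> D \<Longrightarrow> c d = 0" "x = (\<Sum>d\<in>D. c d)"
    using total_decomp[OF gX x(1)] by metis
  let ?E = "insert d D"
  have x': "x = (\<Sum>d\<in>?E. c d)" unfolding D(4) by (rule sum.mono_neutral_left) (use D in auto)
  have gx: "y = (\<Sum>d\<in>?E. g (c d))"
    unfolding x(2)[symmetric] x' by (rule additive_on_sum[OF gX add]) (rule homogeneous_total, rule D(2))
  let ?u = "\<lambda>e. g (c e) - (if e = d then y else 0)"
  have fin: "finite ?E" using D(1) by simp
  have "(\<Sum>e\<in>?E. ?u e) = 0" unfolding sum_subtractf using gx[symmetric] fin by (simp add: sum.delta)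
  moreover have "?u e \<in> Y e" for e
  proof -
    have "g (c e) \<in> Y e" using deg D(2) by blast
    moreover have "- (if e = d then y else 0) \<in> Y e"
      using y graded_group_minus[OF gY] graded_group_zero[OF gY] by auto
    ultimately show ?thesis unfolding diff_conv_add_uminus by (rule graded_group_add[OF gY])
  qed
  ultimately have "?u d = 0" by (intro graded_group_indep[OF gY fin, of ?u d]) auto
  then show ?thesis using D(2) by auto
qed

lemma projective_lift:
  fixes X :: "'d::ab_group_add \<Rightarrow> 'x::ab_group_add set" and Y :: "'d \<Rightarrow> 'y::ab_group_add set"
    and R :: "'d \<Rightarrow> 'r::{ring,monoid_mult} set" and P :: "'d \<Rightarrow> 'm::ab_group_add set"
  assumes mul: "mul = (*) \<or> mul = (\<lambda>r s. s * r)"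
    and R: "graded_ring R" and P: "graded_module mul R P act" and proj: "projective mul R P act"
    and X: "graded_module mul R X aX" and Y: "graded_module mul R Y aY"
    and g: "module_hom R X aX Y aY g" "g ` dsum X = dsum Y"
    and f: "module_hom R P act Y aY f"
  shows "\<exists>h. module_hom R P act X aX h \<and> (\<forall>p\<in>dsum P. g (h p) = f p)"
proof -
  have gR: "graded_group R" and gP: "graded_group P" and gX: "graded_group X" and gY: "graded_group Y"
    using R P X Y unfolding graded_ring_def graded_module_def by auto
  have one: "1 \<in> R 0" using R unfolding graded_ring_def by blast
  have mulD: "mul r s \<in> R (d + e)" if "r \<in> R d" "s \<in> R e" for r s d e
    using mul that R unfolding graded_ring_def by (metis add.commute)
  have mul_add: "mul r (s + t) = mul r s + mul r t" "mul (r + s) t = mul r t + mul s t"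
    and mul_assoc: "mul (mul r s) t = mul r (mul s t)"
    and mul_0: "mul r 0 = 0" "mul 0 r = 0" and mul_1: "mul 1 r = r" "mul r 1 = r" for r s t
    using mul by (auto simp: algebra_simps)
  have actD: "act r m \<in> P (d + e)" if "r \<in> R d" "m \<in> P e" for r m d e
    using that P unfolding graded_module_def by blast
  have XactD: "aX r m \<in> X (d + e)" if "r \<in> R d" "m \<in> X e" for r m d e
    using that X unfolding graded_module_def by blast

  define dg where "dg = (\<lambda>p. SOME e. p \<in> P e)"
  define Hs where "Hs = {p. p \<noteq> 0 \<and> (\<exists>e. p \<in> P e)}"
  have dg: "p \<in> P (dg p)" if "p \<in> Hs" for p
    using that unfolding dg_def Hs_def by (metis (mono_tags, lifting) mem_Collect_eq someI_ex)
  have dg_eq: "e = dg p" if "p \<in> P e" "p \<noteq> 0" for p e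
  proof -
    have "p \<in> P (dg p)" using that dg unfolding Hs_def by blast
    then have "hcomp P p = (\<lambda>i. if i = dg p then p else 0)" "hcomp P p = (\<lambda>i. if i = e then p else 0)"
      using hcomp_homogeneous[OF gP] that(1) by metis+
    then show ?thesis using that(2) by metis
  qed

  define F where "F = (\<lambda>d. {c :: 'm \<Rightarrow> 'r. finite {p. c p \<noteq> 0} \<and>
      (\<forall>p. if p \<in> Hs then c p \<in> R (d - dg p) else c p = 0)})"
  define aF where "aF = (\<lambda>r (c :: 'm \<Rightarrow> 'r) p. mul r (c p))"
  have FR: "c p \<in> R (d - dg p)" if "c \<in> F d" for c d p
    using that graded_group_zero[OF gR] unfolding F_def by (cases "p \<in> Hs") auto

  have gF: "graded_group F"
    unfolding graded_group_def
  proof (intro conjI allI impI ballI)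
    fix d
    have "x + y \<in> F d" if "x \<in> F d" "y \<in> F d" for x y
    proof -
      have "{p. (x + y) p \<noteq> 0} \<subseteq> {p. x p \<noteq> 0} \<union> {p. y p \<noteq> 0}" by auto
      then have "finite {p. (x + y) p \<noteq> 0}" by (rule finite_subset) (use that in \<open>auto simp: F_def\<close>)
      then show ?thesis using that graded_group_add[OF gR] unfolding F_def by (auto split: if_splits)
    qed
    moreover have "- x \<in> F d" if "x \<in> F d" for x
      using that graded_group_minus[OF gR] unfolding F_def by auto
    moreover have "0 \<in> F d" using graded_group_zero[OF gR] unfolding F_def by auto
    ultimately show "add_subgroup (F d)" unfolding add_subgroup_def by blast
  next
    fix D c d assume D: "finite D" "\<forall>d\<in>D. c d \<in> F d" "(\<Sum>d\<in>D. c d) = 0" "d \<in> D"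
    have "c d p = 0" for p
    proof -
      have "(\<Sum>d\<in>D. c d) p = (\<Sum>d\<in>D. c d p)" using D(1) by (induction D rule: finite_induct) auto
      then have s: "(\<Sum>d\<in>D. c d p) = 0" using D(3) by simp
      let ?h = "\<lambda>d. d - dg p"
      have "(\<Sum>e\<in>?h ` D. c (e + dg p) p) = (\<Sum>d\<in>D. c d p)"
        by (subst sum.reindex) (auto simp: inj_on_def)
      then have s': "(\<Sum>e\<in>?h ` D. c (e + dg p) p) = 0" using s by simp
      have "c (?h d + dg p) p = 0"
      proof (rule graded_group_indep[OF gR _ _ s'])
        show "finite (?h ` D)" using D(1) by simp
        show "?h d \<in> ?h ` D" using D(4) by simp
        fix e assume "e \<in> ?h ` D"
        then obtain i where "i \<in> D" "e = i - dg p" by blast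
        then show "c (e + dg p) p \<in> R e" using FR[of "c i" i p] D(2) by auto
      qed
      then show ?thesis by simp
    qed
    then show "c d = 0" by (simp add: fun_eq_iff)
  qed

  have Ftot: "finite {p. c p \<noteq> 0} \<and> (\<forall>p. c p \<in> dsum R \<and> (p \<notin> Hs \<longrightarrow> c p = 0))" if c: "c \<in> dsum F" for c
  proof -
    obtain D k where D: "finite D" "\<And>d. k d \<in> F d" "\<And>d. d \<notin> D \<Longrightarrow> k d = 0" "c = (\<Sum>d\<in>D. k d)"
      using total_decomp[OF gF c] by metis
    have cp: "c p = (\<Sum>d\<in>D. k d p)" for p
      unfolding D(4) using D(1) by (induction D rule: finite_induct) auto
    have "{p. c p \<noteq> 0} \<subseteq> (\<Union>d\<in>D. {p. k d p \<noteq> 0})" by (auto simp: cp intro: ccontr)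
    moreover have "finite (\<Union>d\<in>D. {p. k d p \<noteq> 0})" using D(1,2) unfolding F_def by auto
    moreover have "c p \<in> dsum R" for p unfolding cp
      by (intro total_sum_mem[OF gR]) (rule homogeneous_total, rule FR[OF D(2)])
    moreover have "p \<notin> Hs \<longrightarrow> c p = 0" for p unfolding cp using D(2) unfolding F_def by (auto intro!: sum.neutral)
    ultimately show ?thesis by (meson finite_subset)
  qed

  have mF: "graded_module mul R F aF"
    unfolding graded_module_def
  proof (intro conjI allI ballI gF)
    fix d e r c assume rc: "r \<in> R d" "c \<in> F e"
    have "{p. mul r (c p) \<noteq> 0} \<subseteq> {p. c p \<noteq> 0}" using mul_0 by auto
    then have "finite {p. mul r (c p) \<noteq> 0}" by (rule finite_subset) (use rc in \<open>auto simp: F_def\<close>)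
    moreover have "mul r (c p) \<in> R (d + e - dg p)" for p
      using mulD[OF rc(1) FR[OF rc(2), of p]] by (simp add: add_diff_eq)
    ultimately show "aF r c \<in> F (d + e)" using rc(2) mul_0 unfolding F_def aF_def by auto
  qed (auto simp: additive_on_def aF_def mul_add mul_assoc mul_1 fun_eq_iff)

  have free: "\<exists>k. module_hom R F aF Z aZ k \<and> (\<forall>c\<in>dsum F. k c = (\<Sum>p | c p \<noteq> 0. aZ (c p) (y p)))"
    if Z: "graded_module mul R Z aZ" and y: "\<And>p. p \<in> Hs \<Longrightarrow> y p \<in> Z (dg p)"
    for Z :: "'d \<Rightarrow> 'z::ab_group_add set" and aZ y
  proof (intro exI conjI ballI)
    let ?k = "\<lambda>c. \<Sum>p | c p \<noteq> 0. aZ (c p) (y p)"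
    have gZ: "graded_group Z" using Z unfolding graded_module_def by blast
    have yt: "y p \<in> dsum Z" if "p \<in> Hs" for p using y[OF that] by (rule homogeneous_total)
    have aadd: "aZ (r + s) z = aZ r z + aZ s z" if "r \<in> dsum R" "s \<in> dsum R" "z \<in> dsum Z" for r s z
      using Z that unfolding graded_module_def additive_on_def by blast
    have azero: "aZ 0 z = 0" if "z \<in> dsum Z" for z
      using aadd[OF total_zero total_zero that] by simp
    have atot: "aZ r z \<in> dsum Z" if r: "r \<in> R d" and z: "z \<in> Z e" for r z d e
    proof (rule homogeneous_total)
      show "aZ r z \<in> Z (d + e)" using Z r z unfolding graded_module_def by blast
    qed
    have kT: "?k c = (\<Sum>p\<in>T. aZ (c p) (y p))"
      if "finite T" "{p. c p \<noteq> 0} \<subseteq> T" "T \<subseteq> Hs" for c T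
      by (rule sum.mono_neutral_left[OF that(1,2)]) (use that(3) azero yt in auto)
    have supp: "finite {p. c p \<noteq> 0}" "{p. c p \<noteq> 0} \<subseteq> Hs" "c p \<in> dsum R" if "c \<in> dsum F" for c p
      using Ftot[OF that] by auto
    show "module_hom R F aF Z aZ ?k"
      unfolding module_hom_def
    proof (intro conjI allI ballI subsetI)
      show "additive_on (dsum F) ?k"
        unfolding additive_on_def
      proof (intro ballI)
        fix c e assume c: "c \<in> dsum F" and e: "e \<in> dsum F"
        let ?T = "{p. c p \<noteq> 0} \<union> {p. e p \<noteq> 0}"
        have T: "finite ?T" "?T \<subseteq> Hs" using supp c e by auto
        have "?k (c + e) = (\<Sum>p\<in>?T. aZ ((c + e) p) (y p))" by (rule kT) (use T in auto)
        also have "\<dots> = (\<Sum>p\<in>?T. aZ (c p) (y p) + aZ (e p) (y p))"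
          by (rule sum.cong[OF refl]) (use T(2) aadd supp(3)[OF c] supp(3)[OF e] yt in auto)
        also have "\<dots> = ?k c + ?k e"
          unfolding sum.distrib using kT[OF T(1) _ T(2), of c] kT[OF T(1) _ T(2), of e] by simp
        finally show "?k (c + e) = ?k c + ?k e" .
      qed
      fix d z assume "z \<in> ?k ` F d"
      then obtain c where c: "c \<in> F d" "z = ?k c" by blast
      have sub: "add_subgroup (Z d)" using gZ unfolding graded_group_def by blast
      have "aZ (c p) (y p) \<in> Z d" if "c p \<noteq> 0" for p
      proof -
        have "p \<in> Hs" using c(1) that unfolding F_def by (auto split: if_splits)
        then have "aZ (c p) (y p) \<in> Z (d - dg p + dg p)"
          using Z FR[OF c(1)] y unfolding graded_module_def by blast
        then show ?thesis by simp
      qed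
      then have "(\<Sum>p\<in>S. aZ (c p) (y p)) \<in> Z d" if "S \<subseteq> {p. c p \<noteq> 0}" for S
        using that by (induction S rule: infinite_finite_induct)
          (use sub in \<open>auto simp: add_subgroup_def\<close>)
      then show "z \<in> Z d" using c(2) by blast
    next
      fix r c assume r: "r \<in> dsum R" and c: "c \<in> dsum F"
      have z: "aZ (c p) (y p) \<in> dsum Z" if "p \<in> Hs" for p
      proof -
        obtain D e where D: "finite D" "\<And>d. e d \<in> R d" "c p = (\<Sum>d\<in>D. e d)"
          using total_decomp[OF gR supp(3)[OF c, of p]] by metis
        have "additive_on (dsum R) (\<lambda>r. aZ r (y p))" using Z yt[OF that] unfolding graded_module_def by blast
        then have "aZ (c p) (y p) = (\<Sum>d\<in>D. aZ (e d) (y p))"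
          unfolding D(3) by (rule additive_on_sum[OF gR]) (rule homogeneous_total, rule D(2))
        also have "\<dots> \<in> dsum Z"
          by (rule total_sum_mem[OF gZ]) (rule atot[OF D(2) y[OF that]])
        finally show ?thesis .
      qed
      have "?k (aF r c) = (\<Sum>p | c p \<noteq> 0. aZ (aF r c p) (y p))"
        by (rule kT) (use supp[OF c] mul_0 in \<open>auto simp: aF_def\<close>)
      also have "\<dots> = (\<Sum>p | c p \<noteq> 0. aZ r (aZ (c p) (y p)))"
        by (rule sum.cong[OF refl])
          (use Z r supp[OF c] yt in \<open>auto simp: aF_def graded_module_def\<close>)
      also have "\<dots> = aZ r (?k c)"
        by (rule additive_on_sum[OF gZ, symmetric]) (use Z r z supp(2)[OF c] in \<open>auto simp: graded_module_def\<close>)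
      finally show "?k (aF r c) = aZ r (?k c)" .
    qed
    show "?k c = (\<Sum>p | c p \<noteq> 0. aZ (c p) (y p))" for c ..
  qed

  obtain q where q: "module_hom R F aF P act q" "\<forall>c\<in>dsum F. q c = (\<Sum>p | c p \<noteq> 0. act (c p) p)"
    using free[OF P, of "\<lambda>p. p"] dg by blast
  have qadd: "additive_on (dsum F) q" and qdeg: "\<And>d. q ` F d \<subseteq> P d"
    using q(1) unfolding module_hom_def by auto
  have "\<exists>c\<in>F d. q c = p" if p: "p \<in> P d" for p d
  proof (cases "p = 0")
    case True
    then show ?thesis using graded_group_zero[OF gF] additive_on_zero[OF qadd total_zero] by blast
  next
    case False
    let ?c = "\<lambda>x. if x = p then 1 else (0::'r)"
    have H: "p \<in> Hs" "d = dg p" using dg_eq[OF p False] p False unfolding Hs_def by auto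
    have 0: "act 0 p = 0" "act 1 p = p"
    proof -
      have "additive_on (dsum R) (\<lambda>r. act r p)" using P homogeneous_total[of p P, OF p] unfolding graded_module_def by blast
      from additive_on_zero[OF this total_zero] show "act 0 p = 0" .
      show "act 1 p = p" using P homogeneous_total[of p P, OF p] unfolding graded_module_def by blast
    qed
    have sup: "{x. ?c x \<noteq> 0} = (if (1::'r) = 0 then {} else {p})" by auto
    have c: "?c \<in> F d"
      using H one graded_group_zero[OF gR] sup unfolding F_def by auto
    have "q ?c = (\<Sum>x | ?c x \<noteq> 0. act (?c x) x)"
      by (rule bspec[OF q(2)]) (rule homogeneous_total[of _ F, OF c])
    also have "\<dots> = p" unfolding sup using 0 by auto
    finally show ?thesis using c by blast
  qed note qsurj = this
  have qtot: "q ` dsum F = dsum P"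
  proof
    show "q ` dsum F \<subseteq> dsum P"
    proof
      fix z assume "z \<in> q ` dsum F"
      then obtain c where c: "c \<in> dsum F" "z = q c" by blast
      obtain D k where D: "finite D" "\<And>d. k d \<in> F d" "c = (\<Sum>d\<in>D. k d)" using total_decomp[OF gF c(1)] by metis
      have "z = (\<Sum>d\<in>D. q (k d))" unfolding c(2) D(3)
        by (rule additive_on_sum[OF gF qadd]) (rule homogeneous_total, rule D(2))
      then show "z \<in> dsum P" using total_sum[OF D(1), of "\<lambda>d. q (k d)" P] qdeg D(2) by blast
    qed
    show "dsum P \<subseteq> q ` dsum F"
    proof
      fix p assume "p \<in> dsum P"
      then obtain D e where D: "finite D" "\<And>d. e d \<in> P d" "p = (\<Sum>d\<in>D. e d)" using total_decomp[OF gP] by metis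
      have "\<forall>d. \<exists>c. c \<in> F d \<and> q c = e d" using qsurj[OF D(2)] by blast
      from choice[OF this] obtain k where k: "\<And>d. k d \<in> F d" "\<And>d. q (k d) = e d" by blast
      have "q (\<Sum>d\<in>D. k d) = p" unfolding D(3) k(2)[symmetric]
        by (rule additive_on_sum[OF gF qadd]) (rule homogeneous_total, rule k(1))
      moreover have "(\<Sum>d\<in>D. k d) \<in> dsum F" using total_sum[OF D(1), of k F] k(1) by blast
      ultimately show "p \<in> q ` dsum F" by blast
    qed
  qed
  have "module_hom R P act P act (\<lambda>p. p)" unfolding module_hom_def additive_on_def by auto
  then obtain s where s: "module_hom R P act F aF s" "\<forall>p\<in>dsum P. q (s p) = p"
    using proj mF P q(1) qtot unfolding projective_def by blast

  have fdeg: "f p \<in> Y d" if "p \<in> P d" for p d using f that unfolding module_hom_def by blast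
  have "\<exists>x. x \<in> X (dg p) \<and> g x = f p" if "p \<in> Hs" for p
    using module_hom_homogeneous_preimage[OF X Y g fdeg[OF dg[OF that]]] by blast
  then have "\<forall>p. \<exists>x. p \<in> Hs \<longrightarrow> x \<in> X (dg p) \<and> g x = f p" by blast
  from choice[OF this]
  obtain y where y: "\<And>p. p \<in> Hs \<Longrightarrow> y p \<in> X (dg p)" "\<And>p. p \<in> Hs \<Longrightarrow> g (y p) = f p" by blast
  obtain k where k: "module_hom R F aF X aX k" "\<forall>c\<in>dsum F. k c = (\<Sum>p | c p \<noteq> 0. aX (c p) (y p))"
    using free[OF X y(1)] by blast
  have actT: "a r z \<in> dsum Z" if Z: "graded_module mul R Z a" and r: "r \<in> dsum R" and z: "z \<in> Z d"
    for r z d and Z :: "'d \<Rightarrow> 'z::ab_group_add set" and a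
  proof -
    have gZ: "graded_group Z" using Z unfolding graded_module_def by blast
    have Zd: "a r' z' \<in> Z (i + j)" if "r' \<in> R i" "z' \<in> Z j" for r' z' i j
      using Z that unfolding graded_module_def by blast
    obtain D e where D: "finite D" "\<And>d. e d \<in> R d" "r = (\<Sum>d\<in>D. e d)" using total_decomp[OF gR r] by metis
    have "additive_on (dsum R) (\<lambda>r. a r z)"
      using Z homogeneous_total[of z Z, OF z] unfolding graded_module_def by blast
    then have "a r z = (\<Sum>d\<in>D. a (e d) z)"
      unfolding D(3) by (rule additive_on_sum[OF gR]) (rule homogeneous_total, rule D(2))
    also have "\<dots> \<in> dsum Z"
      by (rule total_sum_mem[OF gZ])
        (rule homogeneous_total, rule Zd[OF D(2) z])
    finally show ?thesis .
  qed
  have gk: "g (k c) = f (q c)" if c: "c \<in> dsum F" for c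
  proof -
    have cH: "p \<in> Hs" if "c p \<noteq> 0" for p
      using Ftot[OF c] that by auto
    have cp: "c p \<in> dsum R" for p using Ftot[OF c] by auto
    have "g (k c) = g (\<Sum>p | c p \<noteq> 0. aX (c p) (y p))" using k(2) c by simp
    also have "\<dots> = (\<Sum>p | c p \<noteq> 0. g (aX (c p) (y p)))"
      by (rule additive_on_sum[OF gX]) (use g(1) actT[OF X cp y(1)] cH in \<open>auto simp: module_hom_def\<close>)
    also have "\<dots> = (\<Sum>p | c p \<noteq> 0. f (act (c p) p))"
    proof (rule sum.cong[OF refl])
      fix p assume "p \<in> {p. c p \<noteq> 0}"
      then have p: "p \<in> Hs" using cH by blast
      have "g (aX (c p) (y p)) = aY (c p) (f p)"
        using g(1) cp homogeneous_total[of "y p" X, OF y(1)[OF p]] y(2)[OF p] unfolding module_hom_def by metis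
      also have "\<dots> = f (act (c p) p)"
        using f cp homogeneous_total[of p P, OF dg[OF p]] unfolding module_hom_def by metis
      finally show "g (aX (c p) (y p)) = f (act (c p) p)" .
    qed
    also have "\<dots> = f (\<Sum>p | c p \<noteq> 0. act (c p) p)"
      by (rule additive_on_sum[OF gP, symmetric]) (use f actT[OF P cp dg] cH in \<open>auto simp: module_hom_def\<close>)
    also have "\<dots> = f (q c)" using q(2) c by simp
    finally show ?thesis .
  qed
  have stot: "s p \<in> dsum F" if p: "p \<in> dsum P" for p
  proof -
    obtain D e where D: "finite D" "\<And>d. e d \<in> P d" "p = (\<Sum>d\<in>D. e d)" using total_decomp[OF gP p] by metis
    have sa: "additive_on (dsum P) s" and sd: "\<And>d. s ` P d \<subseteq> F d" using s(1) unfolding module_hom_def by auto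
    have "s p = (\<Sum>d\<in>D. s (e d))" unfolding D(3)
      by (rule additive_on_sum[OF gP sa]) (rule homogeneous_total, rule D(2))
    moreover have "s (e d) \<in> F d" for d using sd D(2)[of d] by blast
    ultimately show ?thesis using total_sum[OF D(1), of "\<lambda>d. s (e d)" F] by simp
  qed
  have "module_hom R P act X aX (\<lambda>p. k (s p))"
    unfolding module_hom_def
  proof (intro conjI allI ballI)
    show "additive_on (dsum P) (\<lambda>p. k (s p))"
      using s(1) k(1) stot unfolding module_hom_def additive_on_def by simp
    show "(\<lambda>p. k (s p)) ` P d \<subseteq> X d" for d using s(1) k(1) unfolding module_hom_def by blast
    show "k (s (act r m)) = aX r (k (s m))" if "r \<in> dsum R" "m \<in> dsum P" for r m
      using s(1) k(1) stot that unfolding module_hom_def by simp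
  qed
  moreover have "g (k (s p)) = f p" if "p \<in> dsum P" for p
    using gk[OF stot[OF that]] s(2) that by simp
  ultimately show ?thesis by blast
qed

end

theory Submission
  imports Defs
begin

text \<open>
  Left and right traces determine each other by \<open>tr = \<beta> \<circ> t \<circ> \<alpha>\<close>, where \<open>t\<close> is the image of \<open>1\<close> under the
  isomorphism \<open>A \<cong> HOM_L\<close>. Both conditions amount to the existence of finite families \<open>x\<close>, \<open>y\<close> in \<open>A\<close>
  that are dual for the pairing \<open>t (a * b)\<close>: for a nondegenerate pairing, the expansion of every
  element of \<open>A\<close> in the \<open>x j\<close> with right coefficients \<open>t (y j * z)\<close> is equivalent to its expansion in
  the \<open>y j\<close> with left coefficients \<open>t (z * x j)\<close>. A one-sided dual basis together with the
  representability of its coordinate functionals gives one of the two expansions; the other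
  expansion gives finite generation, projectivity and representability on the other side.
  All signs are absorbed into the automorphisms \<open>x \<mapsto> (-1)\<^bsup>p |x|\<^esup> x\<close> of \<open>A\<close>.
\<close>

section \<open>Dual bases of graded modules\<close>

text \<open>These rules would rewrite sums and products of parities as bitwise operations; the sign
  computations below use the ring laws of \<open>bit\<close> instead.\<close>

declare add_bit_eq_xor [simp del] mult_bit_eq_and [simp del]

section \<open>Signs, additive maps and finite sums in graded groups\<close>

lemma koszul_0 [simp]: "koszul 0 x = x" "koszul p 0 = 0"
  unfolding koszul_def by simp_all

lemma koszul_add: "koszul p (x + y) = koszul p x + koszul p y"
  unfolding koszul_def by simp

lemma bit_add_same [simp]: "p + p = (0::bit)"
  by (cases p) auto

lemma koszul_koszul: "koszul p (koszul q x) = koszul (p + q) x"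
  unfolding koszul_def by (cases p; cases q) auto

lemma koszul_minus: "koszul p (- x) = - koszul p x"
  unfolding koszul_def by simp

lemma koszul_mult:
  fixes x y :: "'a::ring"
  shows "koszul p x * y = koszul p (x * y)" "x * koszul p y = koszul p (x * y)"
  unfolding koszul_def by simp_all

lemma koszul_mem: "graded_group M \<Longrightarrow> x \<in> M d \<Longrightarrow> koszul p x \<in> M d"
  unfolding koszul_def by (simp add: graded_group_minus)

lemma additive_on_koszul:
  assumes "additive_on S f" "0 \<in> S" "\<And>x. x \<in> S \<Longrightarrow> - x \<in> S" "x \<in> S"
  shows "f (koszul p x) = koszul p (f x)"
proof -
  have "f (x + - x) = f x + f (- x)"
    using assms unfolding additive_on_def by blast
  then have "f (- x) = - f x"
    using additive_on_zero[OF assms(1,2)] by (simp add: eq_neg_iff_add_eq_0 add.commute)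
  then show ?thesis unfolding koszul_def by simp
qed

lemma total_minus:
  assumes M: "graded_group M" and x: "x \<in> dsum M"
  shows "- x \<in> dsum M"
proof -
  obtain D c where D: "finite D" "\<And>d. c d \<in> M d" "x = (\<Sum>d\<in>D. c d)"
    using total_decomp[OF M x] by metis
  show ?thesis
    unfolding D(3) sum_negf[symmetric]
    by (rule total_sum) (use D graded_group_minus[OF M] in auto)
qed

lemma additive_on_eqI:
  assumes M: "graded_group M" and "additive_on (dsum M) f" "additive_on (dsum M) g"
    and "\<And>d x. x \<in> M d \<Longrightarrow> f x = g x" and x: "x \<in> dsum M"
  shows "f x = g x"
proof -
  obtain D c where D: "finite D" "\<And>d. c d \<in> M d" "x = (\<Sum>d\<in>D. c d)"
    using total_decomp[OF M x] by metis
  show ?thesis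
    unfolding D(3) additive_on_sum[OF M assms(2) homogeneous_total, OF D(2)]
      additive_on_sum[OF M assms(3) homogeneous_total, OF D(2)]
    by (rule sum.cong) (use D(2) assms(4) in auto)
qed

lemma additive_on_total:
  assumes M: "graded_group M" and N: "graded_group N" and f: "additive_on (dsum M) f"
    and deg: "\<And>d x. x \<in> M d \<Longrightarrow> f x \<in> dsum N" and x: "x \<in> dsum M"
  shows "f x \<in> dsum N"
proof -
  obtain D c where D: "finite D" "\<And>d. c d \<in> M d" "x = (\<Sum>d\<in>D. c d)"
    using total_decomp[OF M x] by metis
  show ?thesis
    unfolding D(3) additive_on_sum[OF M f homogeneous_total, OF D(2)]
    by (rule total_sum_mem[OF N]) (rule deg[OF D(2)])
qed

lemma graded_group_sum:
  assumes "graded_group M" "\<And>i. i \<in> I \<Longrightarrow> c i \<in> M d"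
  shows "(\<Sum>i\<in>I. c i) \<in> M d"
  using assms(2)
  by (induction I rule: infinite_finite_induct)
    (auto simp: graded_group_zero[OF assms(1)] graded_group_add[OF assms(1)])

text \<open>Injectivity of \<open>h\<close> keeps the summands in distinct components, so
  independence survives the relabelling. The intended \<open>h\<close> are translations of degrees,
  as they occur for coordinates of free modules, values of graded maps and shifts.\<close>

lemma graded_group_indep_inj:
  assumes M: "graded_group M" and D: "finite D" "inj_on h D"
    and c: "\<And>d. d \<in> D \<Longrightarrow> c d \<in> M (h d)" and s: "(\<Sum>d\<in>D. c d) = 0" and d: "d \<in> D"
  shows "c d = 0"
proof -
  let ?k = "inv_into D h"
  have "(\<Sum>e\<in>h ` D. c (?k e)) = (\<Sum>d\<in>D. c d)"
    unfolding sum.reindex[OF D(2)] using D(2) by (intro sum.cong) auto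
  then have s': "(\<Sum>e\<in>h ` D. c (?k e)) = 0" using s by simp
  have "c (?k (h d)) = 0"
    by (rule graded_group_indep[OF M _ _ s']) (use D c d in auto)
  then show ?thesis using D(2) d by simp
qed

lemma graded_module_act_total:
  assumes R: "graded_ring R" and M: "graded_module mul R M act" and r: "r \<in> dsum R" and m: "m \<in> dsum M"
  shows "act r m \<in> dsum M"
proof (rule additive_on_total[OF _ _ _ _ r])
  show gM: "graded_group M" and "graded_group R" using R M unfolding graded_ring_def graded_module_def by auto
  show "additive_on (dsum R) (\<lambda>r. act r m)" using M m unfolding graded_module_def by blast
  fix d r assume r: "r \<in> R d"
  show "act r m \<in> dsum M"
  proof (rule additive_on_total[OF gM gM _ _ m])
    show "additive_on (dsum M) (act r)"
      using M homogeneous_total[of r R, OF r] unfolding graded_module_def by blast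
    show "act r m \<in> dsum M" if "m \<in> M e" for e m
      using homogeneous_total[of _ M] M r that unfolding graded_module_def by blast
  qed
qed

lemma sum_fun_apply: "(\<Sum>i\<in>I. f i) x = (\<Sum>i\<in>I. f i x)"
  by (induction I rule: infinite_finite_induct) auto

text \<open>Graded dual basis lemma. The homogeneous components of finitely many generators again
  generate, so a finite free graded module \<open>X\<close> maps onto \<open>P\<close> by a
  degree-preserving \<open>q\<close>. Projectivity splits \<open>q\<close>, and the coordinates of
  the section are the \<open>f j\<close>. An index pairs a generator with a degree, hence
  \<open>snd j\<close> is the degree of \<open>e j\<close>. The parameter \<open>mul\<close> treats
  left and right modules at once.\<close>

lemma homogeneous_dual_basis:
  fixes R :: "'d::ab_group_add \<Rightarrow> 'r::{ring,monoid_mult} set" and P :: "'d \<Rightarrow> 'm::ab_group_add set"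
  assumes mul: "mul = (*) \<or> mul = (\<lambda>r s. s * r)"
    and R: "graded_ring R" and P: "graded_module mul R P act"
    and fg: "finitely_generated R P act" and proj: "projective mul R P act"
  obtains J :: "('m \<times> 'd) set" and e f where
    "finite J" "\<And>j. j \<in> J \<Longrightarrow> e j \<in> P (snd j)"
    "\<And>j. j \<in> J \<Longrightarrow> additive_on (dsum P) (f j)"
    "\<And>j d. j \<in> J \<Longrightarrow> f j ` P d \<subseteq> R (d - snd j)"
    "\<And>j r m. j \<in> J \<Longrightarrow> r \<in> dsum R \<Longrightarrow> m \<in> dsum P \<Longrightarrow> f j (act r m) = mul r (f j m)"
    "\<And>m. m \<in> dsum P \<Longrightarrow> m = (\<Sum>j\<in>J. act (f j m) (e j))"
proof -
  have gR: "graded_group R" and gP: "graded_group P"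
    using R P unfolding graded_ring_def graded_module_def by auto
  have mulD: "mul r s \<in> R (d + e)" if "r \<in> R d" "s \<in> R e" for r s d e
    using mul that R unfolding graded_ring_def by (metis add.commute)
  have mul_add: "mul r (s + t) = mul r s + mul r t" "mul (r + s) t = mul r t + mul s t"
    and mul_assoc: "mul (mul r s) t = mul r (mul s t)"
    and mul_0: "mul r 0 = 0" and mul_1: "mul 1 r = r" for r s t
    using mul by (auto simp: algebra_simps)
  obtain S where S: "finite S" "S \<subseteq> dsum P"
    and gen: "\<And>m. m \<in> dsum P \<Longrightarrow> \<exists>c. (\<forall>s\<in>S. c s \<in> dsum R) \<and> m = (\<Sum>s\<in>S. act (c s) s)"
    using fg unfolding finitely_generated_def by blast
  define J where "J = (SIGMA s:S. {d. hcomp P s d \<noteq> 0})"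
  define e where "e = (\<lambda>j :: 'm \<times> 'd. hcomp P (fst j) (snd j))"
  have finJ: "finite J" unfolding J_def
    by (rule finite_SigmaI[OF S(1)]) (use hcomp_props(2)[OF gP] S(2) in blast)
  have e: "e j \<in> P (snd j)" if "j \<in> J" for j
    using that S(2) hcomp_props(1)[OF gP] unfolding J_def e_def by auto
  \<comment> \<open>The free module with one basis vector of degree \<open>snd j\<close> for each
    \<open>j\<close> in \<open>J\<close>; shifting the coefficients by \<open>snd j\<close> is what
    makes \<open>q\<close> preserve degrees.\<close>
  define X where "X = (\<lambda>d. {c :: 'm \<times> 'd \<Rightarrow> 'r. \<forall>j. c j \<in> (if j \<in> J then R (d - snd j) else {0})})"
  define aX where "aX = (\<lambda>r (c :: 'm \<times> 'd \<Rightarrow> 'r) j. mul r (c j))"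
  have Xj: "c j \<in> (if j \<in> J then R (d - snd j) else {0})" if "c \<in> X d" for c d j
    using that unfolding X_def by blast
  have XR: "c j \<in> R (d - snd j)" if "c \<in> X d" for c d j
    using Xj[OF that, of j] graded_group_zero[OF gR, of "d - snd j"] by (auto split: if_splits)
  have X0: "c j = 0" if "c \<in> X d" "j \<notin> J" for c d j
    using Xj[OF that(1), of j] that(2) by simp
  have gX: "graded_group X"
    unfolding graded_group_def
  proof (intro conjI allI impI ballI)
    fix d
    show "add_subgroup (X d)" unfolding add_subgroup_def X_def
      by (auto simp: graded_group_zero[OF gR] graded_group_add[OF gR] graded_group_minus[OF gR]
          split: if_splits)
  next
    fix D c d assume D: "finite D" "\<forall>d\<in>D. c d \<in> X d" "(\<Sum>d\<in>D. c d) = 0" "d \<in> D"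
    have "c d j = 0" for j
    proof -
      have s: "(\<Sum>d\<in>D. c d j) = 0" using D(3) sum_fun_apply[of c D j] by simp
      show ?thesis
        by (rule graded_group_indep_inj[OF gR D(1) _ _ s D(4), where h = "\<lambda>d. d - snd j"])
          (use XR D(2) in \<open>auto simp: inj_on_def\<close>)
    qed
    then show "c d = 0" by (simp add: fun_eq_iff)
  qed

  have mX: "graded_module mul R X aX"
    unfolding graded_module_def
  proof (intro conjI allI ballI gX)
    fix d e r c assume rc: "r \<in> R d" "c \<in> X e"
    have "mul r (c j) \<in> R (d + e - snd j)" for j
      using mulD[OF rc(1) XR[OF rc(2), of j]] by (simp add: add_diff_eq)
    then show "aX r c \<in> X (d + e)" using X0[OF rc(2)] mul_0 unfolding X_def aX_def by auto
  qed (auto simp: additive_on_def aX_def mul_add mul_assoc mul_1 fun_eq_iff)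

  have coord: "additive_on (dsum X) (\<lambda>c. c j)" for j unfolding additive_on_def by simp
  have Xtot: "c j \<in> dsum R" if "c \<in> dsum X" for c j
    by (rule additive_on_total[OF gX gR coord _ that]) (rule homogeneous_total, rule XR)
  have et: "e j \<in> dsum P" if "j \<in> J" for j using e[OF that] by (rule homogeneous_total)
  have aadd: "additive_on (dsum R) (\<lambda>r. act r m)" if "m \<in> dsum P" for m
    using P that unfolding graded_module_def by blast
  have acttot: "act r m \<in> dsum P" if "r \<in> dsum R" "m \<in> dsum P" for r m
    using graded_module_act_total[OF R P that] .

  define q where "q = (\<lambda>c. \<Sum>j\<in>J. act (c j) (e j))"
  have q: "module_hom R X aX P act q"
    unfolding module_hom_def
  proof (intro conjI allI ballI subsetI)
    show "additive_on (dsum X) q"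
      unfolding additive_on_def q_def sum.distrib[symmetric]
      using aadd et Xtot by (auto intro!: sum.cong simp: additive_on_def)
    fix d z assume "z \<in> q ` X d"
    then obtain c where c: "c \<in> X d" "z = q c" by blast
    have "act (c j) (e j) \<in> P (d - snd j + snd j)" if "j \<in> J" for j
      using P XR[OF c(1)] e[OF that] unfolding graded_module_def by blast
    then show "z \<in> P d" unfolding c(2) q_def by (intro graded_group_sum[OF gP]) simp
  next
    fix r c assume r: "r \<in> dsum R" and c: "c \<in> dsum X"
    have "q (aX r c) = (\<Sum>j\<in>J. act r (act (c j) (e j)))" unfolding q_def aX_def
      by (rule sum.cong[OF refl]) (use P r Xtot[OF c] et in \<open>auto simp: graded_module_def\<close>)
    also have "\<dots> = act r (q c)" unfolding q_def
      by (rule additive_on_sum[OF gP, symmetric])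
        (use P r acttot Xtot[OF c] et in \<open>auto simp: graded_module_def\<close>)
    finally show "q (aX r c) = act r (q c)" .
  qed
  have "q ` dsum X = dsum P"
  proof
    show "q ` dsum X \<subseteq> dsum P"
      unfolding q_def using acttot Xtot et by (auto intro!: total_sum_mem[OF gP])
    show "dsum P \<subseteq> q ` dsum X"
    proof
      fix m assume "m \<in> dsum P"
      then obtain c where c: "\<And>s. s \<in> S \<Longrightarrow> c s \<in> dsum R" "m = (\<Sum>s\<in>S. act (c s) s)"
        using gen by metis
      \<comment> \<open>The action is additive, so every homogeneous component of a generator
        \<open>s\<close> can receive the coefficient \<open>c s\<close> of \<open>s\<close>
        itself.\<close>
      define k where "k = (\<lambda>j. if j \<in> J then c (fst j) else 0)"
      have "act (c s) s = (\<Sum>d | hcomp P s d \<noteq> 0. act (k (s, d)) (e (s, d)))" if s: "s \<in> S" for s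
      proof -
        have sP: "s \<in> dsum P" using s S(2) by blast
        have "additive_on (dsum P) (act (c s))" using P c(1)[OF s] unfolding graded_module_def by blast
        then have "act (c s) (\<Sum>d | hcomp P s d \<noteq> 0. hcomp P s d) = (\<Sum>d | hcomp P s d \<noteq> 0. act (c s) (hcomp P s d))"
          by (rule additive_on_sum[OF gP]) (rule homogeneous_total, rule hcomp_props(1)[OF gP sP])
        then show ?thesis unfolding hcomp_props(3)[OF gP sP] k_def e_def J_def using s by simp
      qed
      then have "m = (\<Sum>s\<in>S. \<Sum>d | hcomp P s d \<noteq> 0. act (k (s, d)) (e (s, d)))"
        unfolding c(2) by (rule sum.cong[OF refl])
      also have "\<dots> = q k"
        unfolding q_def J_def
        by (subst sum.Sigma) (use S hcomp_props(2)[OF gP] in \<open>auto simp: subset_iff case_prod_unfold\<close>)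
      finally have "m = q k" .
      moreover have "k \<in> dsum X"
      proof -
        have "\<exists>D u. finite D \<and> (\<forall>d. u d \<in> R d) \<and> k j = (\<Sum>d\<in>D. u d)" if "j \<in> J" for j
        proof -
          have "k j \<in> dsum R" using c(1) that unfolding k_def J_def by auto
          then show ?thesis using total_decomp[OF gR] by metis
        qed
        then obtain D u where D: "\<And>j. j \<in> J \<Longrightarrow> finite (D j)" "\<And>j d. j \<in> J \<Longrightarrow> u j d \<in> R d"
          "\<And>j. j \<in> J \<Longrightarrow> k j = (\<Sum>d\<in>D j. u j d)" by metis
        \<comment> \<open>The coefficients need not be homogeneous, so \<open>k\<close> is split by
          coordinate and by degree; the function with the single entry \<open>u j d\<close> at
          \<open>j\<close> has degree \<open>d + snd j\<close>.\<close>
        have "k = (\<Sum>j\<in>J. \<Sum>d\<in>D j. (\<lambda>i. if i = j then u j d else 0))"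
        proof
          fix i
          have "(\<Sum>j\<in>J. \<Sum>d\<in>D j. (if i = j then u j d else 0)) = (\<Sum>j\<in>J. if i = j then \<Sum>d\<in>D j. u j d else 0)"
            by (rule sum.cong) auto
          also have "\<dots> = k i"
            using finJ D(3) by (simp add: sum.delta k_def)
          finally show "k i = (\<Sum>j\<in>J. \<Sum>d\<in>D j. (\<lambda>i. if i = j then u j d else 0)) i"
            unfolding sum_fun_apply by simp
        qed
        also have "\<dots> \<in> dsum X"
        proof (intro total_sum_mem[OF gX])
          fix j d assume j: "j \<in> J" "d \<in> D j"
          have "(\<lambda>i. if i = j then u j d else 0) \<in> X (d + snd j)"
            using j D(2) graded_group_zero[OF gR] unfolding X_def by auto
          then show "(\<lambda>i. if i = j then u j d else 0) \<in> dsum X" by (rule homogeneous_total)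
        qed
        finally show ?thesis .
      qed
      ultimately show "m \<in> q ` dsum X" by blast
    qed
  qed
  note surj = this
  have "module_hom R P act P act (\<lambda>p. p)" unfolding module_hom_def additive_on_def by auto
  \<comment> \<open>\<open>projective\<close> tests modules in fixed ambient types, and
    \<open>X\<close> lives in another one; \<open>projective_lift\<close> bridges this. Lifting the
    identity of \<open>P\<close> along \<open>q\<close> gives the section \<open>h\<close>.\<close>
  from projective_lift[OF mul R P proj mX P q surj this]
  obtain h where h: "module_hom R P act X aX h" "\<And>p. p \<in> dsum P \<Longrightarrow> q (h p) = p"
    by metis
  have hadd: "additive_on (dsum P) h" using h(1) unfolding module_hom_def by blast
  show thesis
  proof (rule that[of J e "\<lambda>j m. h m j"])
    show "additive_on (dsum P) (\<lambda>m. h m j)" for j using hadd unfolding additive_on_def by simp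
    show "(\<lambda>m. h m j) ` P d \<subseteq> R (d - snd j)" for j d
    proof -
      have "h m \<in> X d" if "m \<in> P d" for m using h(1) that unfolding module_hom_def by blast
      then show ?thesis using XR by blast
    qed
    show "h (act r m) j = mul r (h m j)" if "r \<in> dsum R" "m \<in> dsum P" for r m j
      using h(1) that unfolding module_hom_def aX_def by simp
    show "m = (\<Sum>j\<in>J. act (h m j) (e j))" if "m \<in> dsum P" for m
      using h(2)[OF that] unfolding q_def by simp
  qed (use finJ e in auto)
qed

section \<open>Finite generation and projectivity from a dual basis\<close>

lemma dual_basis_finitely_generated:
  assumes R: "graded_ring R" and P: "graded_module mul R P act"
    and "finite J" "\<And>j. j \<in> J \<Longrightarrow> e j \<in> dsum P"
    and "\<And>j m. j \<in> J \<Longrightarrow> m \<in> dsum P \<Longrightarrow> f j m \<in> dsum R"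
    and "\<And>m. m \<in> dsum P \<Longrightarrow> m = (\<Sum>j\<in>J. act (f j m) (e j))"
  shows "finitely_generated R P act"
  unfolding finitely_generated_def
proof (intro exI[of _ "e ` J"] conjI ballI)
  have gR: "graded_group R" using R unfolding graded_ring_def by auto
  show "finite (e ` J)" "e ` J \<subseteq> dsum P" using assms by auto
  fix m assume m: "m \<in> dsum P"
  \<comment> \<open>The generators form a set, while \<open>e\<close> may repeat values; the
    coefficients of indices with equal \<open>e j\<close> are collected.\<close>
  let ?c = "\<lambda>s. \<Sum>j | j \<in> J \<and> e j = s. f j m"
  have "(\<Sum>s\<in>e ` J. act (?c s) s) = (\<Sum>s\<in>e ` J. \<Sum>j | j \<in> J \<and> e j = s. act (f j m) (e j))"
  proof (rule sum.cong[OF refl])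
    fix s assume "s \<in> e ` J"
    then have "s \<in> dsum P" using assms by auto
    then have "additive_on (dsum R) (\<lambda>r. act r s)" using P unfolding graded_module_def by blast
    then have "act (?c s) s = (\<Sum>j | j \<in> J \<and> e j = s. act (f j m) s)"
      by (rule additive_on_sum[OF gR]) (use assms m in auto)
    then show "act (?c s) s = (\<Sum>j | j \<in> J \<and> e j = s. act (f j m) (e j))" by simp
  qed
  also have "\<dots> = (\<Sum>j\<in>J. act (f j m) (e j))" by (rule sum.image_gen[OF assms(3), symmetric])
  also have "\<dots> = m" using assms(6)[OF m] by simp
  finally show "\<exists>c. (\<forall>s\<in>e ` J. c s \<in> dsum R) \<and> m = (\<Sum>s\<in>e ` J. act (c s) s)"
    using assms m by (intro exI[of _ ?c]) (auto intro!: total_sum_mem[OF gR])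
qed

text \<open>A homomorphism \<open>k\<close> lifts along \<open>g\<close> by choosing preimages
  \<open>z j\<close> of the \<open>k (e j)\<close> and extending with the coordinates
  \<open>f j\<close>. The preimages are taken of degree \<open>dg j\<close>, so that the lift
  preserves degrees.\<close>

lemma dual_basis_projective:
  fixes R :: "'d::ab_group_add \<Rightarrow> 'r::{ring,monoid_mult} set" and P :: "'d \<Rightarrow> 'm::ab_group_add set"
  assumes R: "graded_ring R" and P: "graded_module mul R P act"
    and "\<And>j. j \<in> J \<Longrightarrow> e j \<in> P (dg j)"
    and fadd: "\<And>j. j \<in> J \<Longrightarrow> additive_on (dsum P) (f j)"
    and fdeg: "\<And>j d. j \<in> J \<Longrightarrow> f j ` P d \<subseteq> R (d - dg j)"
    and flin: "\<And>j r m. j \<in> J \<Longrightarrow> r \<in> dsum R \<Longrightarrow> m \<in> dsum P \<Longrightarrow> f j (act r m) = mul r (f j m)"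
    and dual: "\<And>m. m \<in> dsum P \<Longrightarrow> m = (\<Sum>j\<in>J. act (f j m) (e j))"
  shows "projective mul R P act"
  unfolding projective_def
proof (intro allI impI, elim conjE)
  fix X :: "'d \<Rightarrow> ('m \<Rightarrow> 'r) set" and aX and Y :: "'d \<Rightarrow> 'm set" and aY g k
  assume X: "graded_module mul R X aX" and Y: "graded_module mul R Y aY"
    and g: "module_hom R X aX Y aY g" "g ` dsum X = dsum Y" and k: "module_hom R P act Y aY k"
  have gR: "graded_group R" and gP: "graded_group P" and gX: "graded_group X"
    using R P X unfolding graded_ring_def graded_module_def by auto
  have "\<exists>z\<in>X (dg j). g z = k (e j)" if "j \<in> J" for j
    by (rule module_hom_homogeneous_preimage[OF X Y g]) (use k assms(3)[OF that] in \<open>auto simp: module_hom_def\<close>)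
  then obtain z where z: "\<And>j. j \<in> J \<Longrightarrow> z j \<in> X (dg j)" "\<And>j. j \<in> J \<Longrightarrow> g (z j) = k (e j)" by metis
  have zt: "z j \<in> dsum X" and et: "e j \<in> dsum P" if "j \<in> J" for j
    using z(1) assms(3) that by (auto intro: homogeneous_total)
  have ft: "f j m \<in> dsum R" if "j \<in> J" "m \<in> dsum P" for j m
    by (rule additive_on_total[OF gP gR fadd[OF that(1)] _ that(2)])
      (use fdeg[OF that(1)] in \<open>auto intro: homogeneous_total\<close>)
  have aadd: "additive_on (dsum R) (\<lambda>r. aX r m)" if "m \<in> dsum X" for m
    using X that unfolding graded_module_def by blast
  have Xt: "aX r m \<in> dsum X" if "r \<in> dsum R" "m \<in> dsum X" for r m
    using graded_module_act_total[OF R X that] .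
  have Pt: "act r m \<in> dsum P" if "r \<in> dsum R" "m \<in> dsum P" for r m
    using graded_module_act_total[OF R P that] .
  let ?h = "\<lambda>p. \<Sum>j\<in>J. aX (f j p) (z j)"
  have "module_hom R P act X aX ?h"
    unfolding module_hom_def
  proof (intro conjI allI ballI subsetI)
    show "additive_on (dsum P) ?h"
      unfolding additive_on_def sum.distrib[symmetric]
    proof (intro ballI sum.cong refl)
      fix x y j assume "x \<in> dsum P" "y \<in> dsum P" "j \<in> J"
      then show "aX (f j (x + y)) (z j) = aX (f j x) (z j) + aX (f j y) (z j)"
        using aadd[OF zt] fadd ft unfolding additive_on_def by metis
    qed
    fix d u assume "u \<in> ?h ` P d"
    then obtain p where p: "p \<in> P d" "u = ?h p" by blast
    have "aX (f j p) (z j) \<in> X (d - dg j + dg j)" if "j \<in> J" for j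
      using X z(1)[OF that] fdeg[OF that] p(1) unfolding graded_module_def by blast
    then show "u \<in> X d" unfolding p(2) by (intro graded_group_sum[OF gX]) simp
  next
    fix r m assume r: "r \<in> dsum R" and m: "m \<in> dsum P"
    have "?h (act r m) = (\<Sum>j\<in>J. aX r (aX (f j m) (z j)))"
      by (rule sum.cong[OF refl]) (use X r m flin ft zt in \<open>auto simp: graded_module_def\<close>)
    also have "\<dots> = aX r (?h m)"
      by (rule additive_on_sum[OF gX, symmetric])
        (use X r Xt ft[OF _ m] zt in \<open>auto simp: graded_module_def\<close>)
    finally show "?h (act r m) = aX r (?h m)" .
  qed
  moreover have "g (?h p) = k p" if p: "p \<in> dsum P" for p
  proof -
    have "g (?h p) = (\<Sum>j\<in>J. g (aX (f j p) (z j)))"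
      by (rule additive_on_sum[OF gX]) (use g(1) Xt ft[OF _ p] zt in \<open>auto simp: module_hom_def\<close>)
    also have "\<dots> = (\<Sum>j\<in>J. k (act (f j p) (e j)))"
      using g(1) k ft[OF _ p] zt et z(2) by (intro sum.cong) (auto simp: module_hom_def)
    also have "\<dots> = k (\<Sum>j\<in>J. act (f j p) (e j))"
      by (rule additive_on_sum[OF gP, symmetric]) (use k Pt ft[OF _ p] et in \<open>auto simp: module_hom_def\<close>)
    also have "\<dots> = k p" using dual[OF p] by simp
    finally show ?thesis .
  qed
  ultimately show "\<exists>h. module_hom R P act X aX h \<and> (\<forall>p\<in>dsum P. g (h p) = k p)" by blast
qed

section \<open>Homogeneous components and sign twists\<close>

lemma graded_group_reindex:
  assumes M: "graded_group M" and h: "inj h"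
  shows "graded_group (\<lambda>d. M (h d))"
  unfolding graded_group_def
proof (intro conjI allI impI ballI)
  show "add_subgroup (M (h d))" for d using M unfolding graded_group_def by blast
  fix D c d assume "finite D" "\<forall>d\<in>D. c d \<in> M (h d)" "(\<Sum>d\<in>D. c d) = 0" "d \<in> D"
  then show "c d = 0"
    by (intro graded_group_indep_inj[OF M _ inj_on_subset[OF h subset_UNIV], where c = c]) auto
qed

text \<open>A degree-preserving map commutes with taking components, and \<open>f x\<close>, being
  homogeneous of degree \<open>k\<close>, is its own component. In this way a preimage of a
  homogeneous element is replaced by a homogeneous one.\<close>

lemma additive_on_hcomp:
  assumes M: "graded_group M" and N: "graded_group N" and f: "additive_on (dsum M) f"
    and deg: "\<And>d x. x \<in> M d \<Longrightarrow> f x \<in> N d" and x: "x \<in> dsum M" and fx: "f x \<in> N k"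
  shows "f (hcomp M x k) = f x"
proof -
  let ?D = "insert k {d. hcomp M x d \<noteq> 0}"
  \<comment> \<open>Subtracting \<open>f x\<close> in degree \<open>k\<close> alone makes the family
    sum to zero, so independence kills its term at \<open>k\<close>.\<close>
  let ?c = "\<lambda>d. f (hcomp M x d) - (if d = k then f x else 0)"
  have c: "hcomp M x d \<in> M d" and D: "finite ?D" for d
    using hcomp_props[OF M x] by auto
  have "(\<Sum>d\<in>?D. hcomp M x d) = x"
    using hcomp_props(3)[OF M x] D
    by (subst sum.mono_neutral_right[of ?D "{d. hcomp M x d \<noteq> 0}"]) auto
  then have "(\<Sum>d\<in>?D. f (hcomp M x d)) = f x"
    unfolding additive_on_sum[OF M f homogeneous_total[of "hcomp M x _" M], OF c, symmetric] by simp
  then have s: "(\<Sum>d\<in>?D. ?c d) = 0" using D by (simp add: sum_subtractf sum.delta')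
  have "?c k = 0"
  proof (rule graded_group_indep[OF N D _ s])
    have "- (if d = k then f x else 0) \<in> N d" for d
      using fx graded_group_minus[OF N] graded_group_zero[OF N] by simp
    then show "?c d \<in> N d" for d
      unfolding diff_conv_add_uminus by (intro graded_group_add[OF N] deg[OF c])
  qed simp
  then show ?thesis by simp
qed

lemma hext_plus: "hext M (\<lambda>d x. F d x + G d x) x = hext M F x + hext M G x"
  unfolding hext_def by (rule sum.distrib)

text \<open>In \<open>bit\<close> addition and subtraction agree, so the shift is a translation by
  \<open>- s\<close> in both coordinates of the degree.\<close>

lemma shift_eq: "shift s M = (\<lambda>d. M (d - s))"
proof
  fix d show "shift s M d = M (d - s)"
    unfolding shift_def by (cases d; cases s; cases "snd s"; cases "snd d") auto
qed

text \<open>The identity for \<open>p = 0\<close> and the parity involution for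
  \<open>p = 1\<close>. Being defined on inhomogeneous elements too, it allows sign rules without
  reference to degrees.\<close>

definition sign_twist :: "('l \<times> bit \<Rightarrow> 'm::ab_group_add set) \<Rightarrow> bit \<Rightarrow> 'm \<Rightarrow> 'm" where
  "sign_twist M p = hext M (\<lambda>d. koszul (p * snd d))"

lemma sign_twist_homogeneous:
  "graded_group M \<Longrightarrow> x \<in> M d \<Longrightarrow> sign_twist M p x = koszul (p * snd d) x"
  unfolding sign_twist_def by (rule hext_homogeneous) auto

lemma sign_twist_add:
  "graded_group M \<Longrightarrow> x \<in> dsum M \<Longrightarrow> y \<in> dsum M \<Longrightarrow>
    sign_twist M p (x + y) = sign_twist M p x + sign_twist M p y"
  unfolding sign_twist_def by (rule hext_add) (auto simp: additive_on_def koszul_add)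

lemma graded_automorphism_mem:
  assumes "graded_automorphism R \<sigma>"
  shows "x \<in> R d \<Longrightarrow> \<sigma> x \<in> R d" and "x \<in> dsum R \<Longrightarrow> \<sigma> x \<in> dsum R"
  using assms unfolding graded_automorphism_def bij_betw_def by blast+

lemma graded_automorphism_inv:
  assumes R: "graded_ring R" and \<sigma>: "graded_automorphism R \<sigma>"
  shows "graded_automorphism R (aut_inv R \<sigma>)"
    and "\<And>x. x \<in> dsum R \<Longrightarrow> \<sigma> (aut_inv R \<sigma> x) = x"
    and "\<And>x. x \<in> dsum R \<Longrightarrow> aut_inv R \<sigma> (\<sigma> x) = x"
proof -
  let ?i = "aut_inv R \<sigma>"
  have gR: "graded_group R" and one: "1 \<in> dsum R"
    using R homogeneous_total[of 1 R 0] unfolding graded_ring_def by auto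
  have b: "bij_betw \<sigma> (dsum R) (dsum R)" and add: "additive_on (dsum R) \<sigma>"
    and mult: "\<And>x y. x \<in> dsum R \<Longrightarrow> y \<in> dsum R \<Longrightarrow> \<sigma> (x * y) = \<sigma> x * \<sigma> y"
    and "\<sigma> 1 = 1" and deg: "\<And>d. \<sigma> ` R d = R d"
    using \<sigma> unfolding graded_automorphism_def by auto
  show right: "\<sigma> (?i x) = x" if "x \<in> dsum R" for x
    unfolding aut_inv_def by (rule bij_betw_inv_into_right[OF b that])
  show left: "?i (\<sigma> x) = x" if "x \<in> dsum R" for x
    unfolding aut_inv_def by (rule bij_betw_inv_into_left[OF b that])
  have bi: "bij_betw ?i (dsum R) (dsum R)" unfolding aut_inv_def by (rule bij_betw_inv_into[OF b])
  then have it: "?i x \<in> dsum R" if "x \<in> dsum R" for x using that bij_betwE by blast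
  have mt: "x * y \<in> dsum R" if "x \<in> dsum R" "y \<in> dsum R" for x y
  proof (rule graded_module_act_total[OF R _ that])
    show "graded_module (*) R R (*)"
      using R unfolding graded_module_def graded_ring_def additive_on_def
      by (auto simp: algebra_simps)
  qed
  show "graded_automorphism R ?i"
    unfolding graded_automorphism_def
  proof (intro conjI allI ballI bi)
    show "additive_on (dsum R) ?i"
      unfolding additive_on_def
    proof (intro ballI)
      fix x y assume xy: "x \<in> dsum R" "y \<in> dsum R"
      have "?i (\<sigma> (?i x + ?i y)) = ?i (x + y)"
        using add xy it right unfolding additive_on_def by auto
      then show "?i (x + y) = ?i x + ?i y" using left[OF total_add[OF gR it it]] xy by simp
    qed
    show "?i (x * y) = ?i x * ?i y" if xy: "x \<in> dsum R" "y \<in> dsum R" for x y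
    proof -
      have "?i (\<sigma> (?i x * ?i y)) = ?i (x * y)" using mult xy it right by auto
      then show ?thesis using left[OF mt[OF it it]] xy by simp
    qed
    show "?i 1 = 1" using left[OF one] \<open>\<sigma> 1 = 1\<close> by simp
    fix d
    have "?i ` R d = (\<lambda>x. ?i (\<sigma> x)) ` R d" unfolding image_image[symmetric] deg ..
    also have "\<dots> = R d" using left[OF homogeneous_total[of _ R]] by (simp cong: image_cong)
    finally show "?i ` R d = R d" .
  qed
qed

lemma graded_group_HOM_L:
  assumes M: "graded_group M" and N: "graded_group N"
    and lN: "\<And>b y z. b \<in> dsum R \<Longrightarrow> lN b (y + z) = lN b y + lN b z"
  shows "graded_group (HOM_L R M lM N lN)"
  unfolding graded_group_def
proof (intro conjI allI impI ballI)
  fix d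
  have z: "lN b 0 = 0" if "b \<in> dsum R" for b using lN[OF that, of 0 0] by simp
  have m: "lN b (- y) = - lN b y" if "b \<in> dsum R" for b y
    using lN[OF that, of y "- y"] z[OF that] by (simp add: eq_neg_iff_add_eq_0 add.commute)
  show "add_subgroup (HOM_L R M lM N lN d)"
    unfolding add_subgroup_def
  proof (intro conjI ballI)
    show "0 \<in> HOM_L R M lM N lN d"
      unfolding HOM_L_def by (auto simp: additive_on_def homogeneous_total z graded_group_zero[OF N])
    fix f assume f: "f \<in> HOM_L R M lM N lN d"
    show "- f \<in> HOM_L R M lM N lN d"
      using f unfolding HOM_L_def
      by (auto simp: additive_on_def homogeneous_total m koszul_minus image_subset_iff intro!: graded_group_minus[OF N])
    fix g assume g: "g \<in> HOM_L R M lM N lN d"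
    show "f + g \<in> HOM_L R M lM N lN d"
      using f g unfolding HOM_L_def
      by (auto simp: additive_on_def homogeneous_total lN koszul_add image_subset_iff
          intro!: graded_group_add[OF N])
  qed
next
  fix D c d
  assume D: "finite D" "\<forall>d\<in>D. c d \<in> HOM_L R M lM N lN d" "(\<Sum>d\<in>D. c d) = 0" "d \<in> D"
  \<comment> \<open>At a fixed homogeneous \<open>x\<close> the values of maps of different degrees
    lie in different components of \<open>N\<close>. Additivity then covers \<open>dsum M\<close>,
    and the vanishing convention covers all other points.\<close>
  have 0: "c d x = 0" if x: "x \<in> M e" for x e
  proof (rule graded_group_indep_inj[OF N D(1) _ _ _ D(4), where h = "\<lambda>d. e + d"])
    show "(\<Sum>d\<in>D. c d x) = 0" using D(3) sum_fun_apply[of c D x] by simp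
    show "c i x \<in> N (e + i)" if "i \<in> D" for i using D(2) that x unfolding HOM_L_def by blast
  qed (simp add: inj_on_def)
  have "c d x = 0" for x
  proof (cases "x \<in> dsum M")
    case True
    show ?thesis
      by (rule additive_on_eqI[OF M _ _ _ True, of _ "\<lambda>_. 0"])
        (use D(2,4) 0 in \<open>auto simp: HOM_L_def additive_on_def\<close>)
  qed (use D(2,4) in \<open>auto simp: HOM_L_def\<close>)
  then show "c d = 0" by (simp add: fun_eq_iff)
qed

section \<open>The data of the extension and the calculus of its automorphisms and sign
  twists\<close>

locale twisted_extension =
  fixes A B :: "'l::ab_group_add \<times> bit \<Rightarrow> 'a::{ring,monoid_mult} set"
    and \<alpha> \<beta> :: "'a \<Rightarrow> 'a" and lam :: 'l and \<pi> :: bit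
  assumes A: "graded_superring A" and B: "graded_subring B A"
    and \<alpha>: "graded_automorphism A \<alpha>" and \<beta>: "graded_automorphism B \<beta>"
begin

abbreviation \<alpha>' where "\<alpha>' \<equiv> aut_inv A \<alpha>"
abbreviation \<beta>' where "\<beta>' \<equiv> aut_inv B \<beta>"
abbreviation sg where "sg \<equiv> sign_twist A"

lemma rA: "graded_ring A" and gA: "graded_group A" and rB: "graded_ring B" and gB: "graded_group B"
  and total [simp]: "dsum A = UNIV" and BA: "x \<in> B d \<Longrightarrow> x \<in> A d"
  and one: "1 \<in> A 0"
  using A B unfolding graded_superring_def graded_subring_def graded_ring_def by blast+

lemma mult_A: "x \<in> A d \<Longrightarrow> y \<in> A e \<Longrightarrow> x * y \<in> A (d + e)"
  using rA rB unfolding graded_ring_def by blast+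

lemma left_module: "graded_left_module B A (*)" and right_module: "graded_right_module B A (\<lambda>b x. x * b)"
proof -
  have "b * x \<in> A (d + e)" "x * b \<in> A (d + e)" if "b \<in> B d" "x \<in> A e" for b x d e
    using mult_A[OF BA[OF that(1)] that(2)] mult_A[OF that(2) BA[OF that(1)]] by (simp_all add: add.commute)
  then show "graded_left_module B A (*)" "graded_right_module B A (\<lambda>b x. x * b)"
    using gA unfolding graded_module_def additive_on_def by (simp_all add: algebra_simps)
qed

lemma additive_A: "(\<And>x y. f (x + y) = f x + f y) \<Longrightarrow> additive_on (dsum A) f"
  unfolding additive_on_def by simp

lemma additive_sum:
  fixes f :: "'a \<Rightarrow> 'b::ab_group_add"
  assumes "\<And>x y. f (x + y) = f x + f y" shows "f (\<Sum>i\<in>I. c i) = (\<Sum>i\<in>I. f (c i))"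
  by (rule additive_on_sum[OF gA additive_A]) (use assms in auto)

lemma additive_eqI:
  fixes f g :: "'a \<Rightarrow> 'b::ab_group_add"
  assumes "\<And>x y. f (x + y) = f x + f y" "\<And>x y. g (x + y) = g x + g y" "\<And>d x. x \<in> A d \<Longrightarrow> f x = g x"
  shows "f x = g x"
  by (rule additive_on_eqI[OF gA additive_A additive_A]) (use assms in auto)

lemma \<alpha>_add: "\<alpha> (x + y) = \<alpha> x + \<alpha> y" and \<alpha>_mult: "\<alpha> (x * y) = \<alpha> x * \<alpha> y" and \<alpha>_1 [simp]: "\<alpha> 1 = 1"
  and \<alpha>_mem: "x \<in> A d \<Longrightarrow> \<alpha> x \<in> A d"
  using \<alpha> graded_automorphism_mem(1)[OF \<alpha>] unfolding graded_automorphism_def additive_on_def by auto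

lemma \<alpha>_inv [simp]: "\<alpha> (\<alpha>' x) = x" "\<alpha>' (\<alpha> x) = x"
  using graded_automorphism_inv(2,3)[OF rA \<alpha>] by auto

lemma \<alpha>'_add: "\<alpha>' (x + y) = \<alpha>' x + \<alpha>' y" and \<alpha>'_mult: "\<alpha>' (x * y) = \<alpha>' x * \<alpha>' y"
  and \<alpha>'_mem: "x \<in> A d \<Longrightarrow> \<alpha>' x \<in> A d"
  using graded_automorphism_inv(1)[OF rA \<alpha>] graded_automorphism_mem(1)[OF graded_automorphism_inv(1)[OF rA \<alpha>]]
  unfolding graded_automorphism_def additive_on_def by auto

lemma \<alpha>_0 [simp]: "\<alpha> 0 = 0" and \<alpha>'_0 [simp]: "\<alpha>' 0 = 0"
  using \<alpha>_add[of 0 0] \<alpha>'_add[of 0 0] by auto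

lemma \<beta>_add: "x \<in> dsum B \<Longrightarrow> y \<in> dsum B \<Longrightarrow> \<beta> (x + y) = \<beta> x + \<beta> y"
  and \<beta>_mult: "x \<in> dsum B \<Longrightarrow> y \<in> dsum B \<Longrightarrow> \<beta> (x * y) = \<beta> x * \<beta> y"
  and \<beta>_mem: "x \<in> B d \<Longrightarrow> \<beta> x \<in> B d" and \<beta>_total: "x \<in> dsum B \<Longrightarrow> \<beta> x \<in> dsum B"
  using \<beta> graded_automorphism_mem[OF \<beta>] unfolding graded_automorphism_def additive_on_def bij_betw_def by auto

lemma \<beta>_inv [simp]: "x \<in> dsum B \<Longrightarrow> \<beta> (\<beta>' x) = x" "x \<in> dsum B \<Longrightarrow> \<beta>' (\<beta> x) = x"
  using graded_automorphism_inv(2,3)[OF rB \<beta>] by auto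

lemma \<beta>'_add: "x \<in> dsum B \<Longrightarrow> y \<in> dsum B \<Longrightarrow> \<beta>' (x + y) = \<beta>' x + \<beta>' y"
  and \<beta>'_mult: "x \<in> dsum B \<Longrightarrow> y \<in> dsum B \<Longrightarrow> \<beta>' (x * y) = \<beta>' x * \<beta>' y"
  and \<beta>'_mem: "x \<in> B d \<Longrightarrow> \<beta>' x \<in> B d" and \<beta>'_total: "x \<in> dsum B \<Longrightarrow> \<beta>' x \<in> dsum B"
  using graded_automorphism_inv(1)[OF rB \<beta>] graded_automorphism_mem[OF graded_automorphism_inv(1)[OF rB \<beta>]]
  unfolding graded_automorphism_def additive_on_def bij_betw_def by auto

lemma \<beta>_0 [simp]: "\<beta> 0 = 0" and \<beta>'_0 [simp]: "\<beta>' 0 = 0"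
  using \<beta>_add[of 0 0] \<beta>'_add[of 0 0] total_zero by auto

lemma sg_homogeneous: "x \<in> A d \<Longrightarrow> sg p x = koszul (p * snd d) x"
  by (rule sign_twist_homogeneous[OF gA])

lemma sg_add: "sg p (x + y) = sg p x + sg p y"
  by (rule sign_twist_add[OF gA]) auto

lemma sg_sum: "sg p (\<Sum>i\<in>I. c i) = (\<Sum>i\<in>I. sg p (c i))"
  by (rule additive_sum) (rule sg_add)

lemma sg_mem: "x \<in> A d \<Longrightarrow> sg p x \<in> A d" and sg_mem_B: "x \<in> B d \<Longrightarrow> sg p x \<in> B d"
  using koszul_mem[OF gA] koszul_mem[OF gB] sg_homogeneous sg_homogeneous[OF BA] by simp_all

lemma sg_total_B: "x \<in> dsum B \<Longrightarrow> sg p x \<in> dsum B"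
  by (rule additive_on_total[OF gB gB, of "sg p"])
    (auto simp: additive_on_def sg_add intro: homogeneous_total sg_mem_B)

text \<open>Parities add under multiplication, so the signs of homogeneous factors multiply;
  additivity in each factor separately gives the general case.\<close>

lemma sg_mult: "sg p (x * y) = sg p x * sg p y"
proof (rule additive_eqI[of _ "\<lambda>x. sg p x * sg p y"])
  fix d x assume x: "x \<in> A d"
  show "sg p (x * y) = sg p x * sg p y"
  proof (rule additive_eqI[of "\<lambda>y. sg p (x * y)"])
    fix e y assume y: "y \<in> A e"
    show "sg p (x * y) = sg p x * sg p y"
      by (simp add: sg_homogeneous[OF mult_A[OF x y]] sg_homogeneous[OF x] sg_homogeneous[OF y]
          koszul_mult koszul_koszul distrib_left add.commute)
  qed (auto simp: sg_add algebra_simps)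
qed (auto simp: sg_add algebra_simps)

lemma sg_sg: "sg p (sg q x) = sg (p + q) x"
  by (rule additive_eqI[of "\<lambda>x. sg p (sg q x)"])
    (auto simp: sg_add sg_homogeneous sg_homogeneous[OF koszul_mem[OF gA]] koszul_koszul distrib_right)

lemma sg_0 [simp]: "sg 0 x = x" "sg p 0 = 0"
proof -
  show "sg 0 x = x" by (rule additive_eqI[of "sg 0"]) (auto simp: sg_add sg_homogeneous)
  show "sg p 0 = 0" using sg_add[of p 0 0] by simp
qed

lemma sg_inv [simp]: "sg p (sg p x) = x"
  by (simp add: sg_sg)

lemma \<beta>_sg: "b \<in> dsum B \<Longrightarrow> \<beta> (sg p b) = sg p (\<beta> b)"
proof (rule additive_on_eqI[OF gB, of "\<lambda>x. \<beta> (sg p x)"])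
  fix d x assume x: "x \<in> B d"
  have "\<beta> (koszul q x) = koszul q (\<beta> x)" for q
    by (rule additive_on_koszul[of "dsum B"])
      (use x homogeneous_total[of x B] in \<open>auto simp: additive_on_def \<beta>_add total_zero total_minus[OF gB]\<close>)
  then show "\<beta> (sg p x) = sg p (\<beta> x)"
    using sg_homogeneous[OF BA[OF x]] sg_homogeneous[OF BA[OF \<beta>_mem[OF x]]] by simp
qed (auto simp: additive_on_def sg_add \<beta>_add sg_total_B)

lemma \<beta>'_sg: "b \<in> dsum B \<Longrightarrow> \<beta>' (sg p b) = sg p (\<beta>' b)"
  using \<beta>_sg[of "\<beta>' b" p] by (metis \<beta>'_total \<beta>_inv sg_total_B)

section \<open>Twisted traces\<close>

text \<open>Covers both sides: with \<open>\<alpha>'\<close> and \<open>\<beta>'\<close> it is the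
  bimodule homomorphism of the theorem, with \<open>\<beta>\<close> and \<open>\<alpha>\<close> it
  describes the image of \<open>1\<close> under an isomorphism onto \<open>homs\<close>. The degree
  condition and the twist \<open>sg \<pi>\<close> come from the shift by
  \<open>(lam, \<pi>)\<close>.\<close>

definition twisted_trace :: "('a \<Rightarrow> 'a) \<Rightarrow> ('a \<Rightarrow> 'a) \<Rightarrow> ('a \<Rightarrow> 'a) \<Rightarrow> bool" where
  "twisted_trace \<sigma> \<rho> t \<longleftrightarrow> (\<forall>x y. t (x + y) = t x + t y) \<and> (\<forall>d. \<forall>x\<in>A d. t x \<in> B (d - (lam, \<pi>))) \<and>
     (\<forall>b\<in>dsum B. \<forall>x. t (\<sigma> b * x) = sg \<pi> b * t x) \<and> (\<forall>b\<in>dsum B. \<forall>x. t (x * \<rho> b) = t x * b)"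

lemma twisted_traceD:
  assumes "twisted_trace \<sigma> \<rho> t"
  shows "t (x + y) = t x + t y" "x \<in> A d \<Longrightarrow> t x \<in> B (d - (lam, \<pi>))"
    "b \<in> dsum B \<Longrightarrow> t (\<sigma> b * x) = sg \<pi> b * t x" "b \<in> dsum B \<Longrightarrow> t (x * \<rho> b) = t x * b"
    "t 0 = 0" "t x \<in> dsum B" "t (\<Sum>i\<in>I. c i) = (\<Sum>i\<in>I. t (c i))"
proof -
  show add: "t (x + y) = t x + t y" for x y using assms unfolding twisted_trace_def by blast
  show deg: "x \<in> A d \<Longrightarrow> t x \<in> B (d - (lam, \<pi>))" for x d using assms unfolding twisted_trace_def by blast
  show "b \<in> dsum B \<Longrightarrow> t (\<sigma> b * x) = sg \<pi> b * t x" "b \<in> dsum B \<Longrightarrow> t (x * \<rho> b) = t x * b"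
    using assms unfolding twisted_trace_def by blast+
  show "t 0 = 0" using add[of 0 0] by simp
  show "t x \<in> dsum B"
    by (rule additive_on_total[OF gA gB additive_A], rule add, rule homogeneous_total, erule deg) simp
  show "t (\<Sum>i\<in>I. c i) = (\<Sum>i\<in>I. t (c i))" by (rule additive_sum) (rule add)
qed

text \<open>The inner \<open>\<alpha>\<close> turns the left factor \<open>\<alpha>' b\<close> into
  \<open>b = \<beta> (\<beta>' b)\<close>, which \<open>t\<close> takes out as
  \<open>\<beta>' b\<close> up to sign; the outer \<open>\<beta>\<close> restores \<open>b\<close>.
  On the right, \<open>\<beta>' b\<close> becomes \<open>\<alpha> (\<beta>' b)\<close> and is taken
  out likewise.\<close>

lemma trace_to_right:
  assumes t: "twisted_trace \<beta> \<alpha> t"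
  shows "twisted_trace \<alpha>' \<beta>' (\<lambda>x. \<beta> (t (\<alpha> x)))"
  unfolding twisted_trace_def
proof (intro conjI allI ballI)
  note T = twisted_traceD[OF t]
  show "\<beta> (t (\<alpha> (x + y))) = \<beta> (t (\<alpha> x)) + \<beta> (t (\<alpha> y))" for x y
    by (simp add: \<alpha>_add T(1) \<beta>_add T(6))
  show "\<beta> (t (\<alpha> x)) \<in> B (d - (lam, \<pi>))" if "x \<in> A d" for x d
    by (intro \<beta>_mem T(2) \<alpha>_mem that)
  fix b x assume b: "b \<in> dsum B"
  have "t (\<alpha> (\<alpha>' b * x)) = sg \<pi> (\<beta>' b) * t (\<alpha> x)"
    using T(3)[OF \<beta>'_total[OF b], of "\<alpha> x"] b by (simp add: \<alpha>_mult)
  then show "\<beta> (t (\<alpha> (\<alpha>' b * x))) = sg \<pi> b * \<beta> (t (\<alpha> x))"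
    using b by (simp add: \<beta>_mult T(6) sg_total_B \<beta>'_total \<beta>_sg)
  have "t (\<alpha> (x * \<beta>' b)) = t (\<alpha> x) * \<beta>' b"
    using T(4)[OF \<beta>'_total[OF b], of "\<alpha> x"] by (simp add: \<alpha>_mult)
  then show "\<beta> (t (\<alpha> (x * \<beta>' b))) = \<beta> (t (\<alpha> x)) * b"
    using b by (simp add: \<beta>_mult T(6) \<beta>'_total)
qed

text \<open>The inverse of the transport in \<open>trace_to_right\<close>.\<close>

lemma trace_to_left:
  assumes t: "twisted_trace \<alpha>' \<beta>' t"
  shows "twisted_trace \<beta> \<alpha> (\<lambda>x. \<beta>' (t (\<alpha>' x)))"
  unfolding twisted_trace_def
proof (intro conjI allI ballI)
  note T = twisted_traceD[OF t]
  show "\<beta>' (t (\<alpha>' (x + y))) = \<beta>' (t (\<alpha>' x)) + \<beta>' (t (\<alpha>' y))" for x y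
    by (simp add: \<alpha>'_add T(1) \<beta>'_add T(6))
  show "\<beta>' (t (\<alpha>' x)) \<in> B (d - (lam, \<pi>))" if "x \<in> A d" for x d
    by (intro \<beta>'_mem T(2) \<alpha>'_mem that)
  fix b x assume b: "b \<in> dsum B"
  have "t (\<alpha>' (\<beta> b * x)) = sg \<pi> (\<beta> b) * t (\<alpha>' x)"
    using T(3)[OF \<beta>_total[OF b], of "\<alpha>' x"] b by (simp add: \<alpha>'_mult)
  then show "\<beta>' (t (\<alpha>' (\<beta> b * x))) = sg \<pi> b * \<beta>' (t (\<alpha>' x))"
    using b by (simp add: \<beta>'_mult T(6) sg_total_B \<beta>_total \<beta>'_sg)
  have "t (\<alpha>' (x * \<alpha> b)) = t (\<alpha>' x) * \<beta> b"
    using T(4)[OF \<beta>_total[OF b], of "\<alpha>' x"] b by (simp add: \<alpha>'_mult)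
  then show "\<beta>' (t (\<alpha>' (x * \<alpha> b))) = \<beta>' (t (\<alpha>' x)) * b"
    using b by (simp add: \<beta>'_mult T(6) \<beta>_total)
qed

text \<open>Both sides have the same pairing with every \<open>w\<close>: the coefficients move
  across the product until the right expansion of \<open>w\<close> appears. Nondegeneracy in the
  left argument then identifies them.\<close>

lemma left_expansion:
  assumes t: "twisted_trace \<sigma> \<rho> t" and nondeg: "\<And>a. (\<And>x. t (a * x) = 0) \<Longrightarrow> a = 0"
    and right: "\<And>z. z = (\<Sum>j\<in>J. x j * \<rho> (t (y j * z)))"
  shows "z = (\<Sum>j\<in>J. \<sigma> (sg \<pi> (t (z * x j))) * y j)" (is "_ = ?z")
proof -
  note T = twisted_traceD[OF t]
  have "t (?z * w) = t (z * w)" for w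
  proof -
    have "t (?z * w) = (\<Sum>j\<in>J. t (\<sigma> (sg \<pi> (t (z * x j))) * (y j * w)))"
      by (simp add: sum_distrib_right T(7) mult.assoc)
    \<comment> \<open>Both summands equal \<open>t (z * x j) * t (y j * w)\<close>: the twist in the
      coefficient cancels the one produced by left linearity of \<open>t\<close>.\<close>
    also have "\<dots> = (\<Sum>j\<in>J. t (z * x j * \<rho> (t (y j * w))))"
      by (simp add: T(3)[OF sg_total_B[OF T(6)]] T(4)[OF T(6)])
    also have "\<dots> = t (z * (\<Sum>j\<in>J. x j * \<rho> (t (y j * w))))"
      by (simp add: sum_distrib_left T(7) mult.assoc)
    also have "\<dots> = t (z * w)" using right[of w] by simp
    finally show ?thesis .
  qed
  then have "t ((z - ?z) * w) = 0" for w
    using T(1)[of "(z - ?z) * w" "?z * w"] by (simp add: left_diff_distrib)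
  from nondeg[OF this] show ?thesis by simp
qed

text \<open>Mirror image of \<open>left_expansion\<close>, with \<open>w\<close> paired from the
  left and nondegeneracy in the right argument.\<close>

lemma right_expansion:
  assumes t: "twisted_trace \<sigma> \<rho> t" and nondeg: "\<And>a. (\<And>x. t (x * a) = 0) \<Longrightarrow> a = 0"
    and left: "\<And>z. z = (\<Sum>j\<in>J. \<sigma> (sg \<pi> (t (z * x j))) * y j)"
  shows "z = (\<Sum>j\<in>J. x j * \<rho> (t (y j * z)))" (is "_ = ?z")
proof -
  note T = twisted_traceD[OF t]
  have "t (w * ?z) = t (w * z)" for w
  proof -
    have "t (w * ?z) = (\<Sum>j\<in>J. t (w * x j * \<rho> (t (y j * z))))"
      by (simp add: sum_distrib_left T(7) mult.assoc)
    also have "\<dots> = (\<Sum>j\<in>J. t (\<sigma> (sg \<pi> (t (w * x j))) * (y j * z)))"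
      by (simp add: T(3)[OF sg_total_B[OF T(6)]] T(4)[OF T(6)])
    also have "\<dots> = t ((\<Sum>j\<in>J. \<sigma> (sg \<pi> (t (w * x j))) * y j) * z)"
      by (simp add: sum_distrib_right T(7) mult.assoc)
    also have "\<dots> = t (w * z)" using left[of w] by simp
    finally show ?thesis .
  qed
  then have "t (w * (z - ?z)) = 0" for w
    using T(1)[of "w * (z - ?z)" "w * ?z"] by (simp add: right_diff_distrib)
  from nondeg[OF this] show ?thesis by simp
qed

text \<open>For homogeneous \<open>x\<close> the map \<open>a \<mapsto> t (x * a)\<close> shifts
  degrees by a constant, so it preserves degrees for a regraded target and
  \<open>additive_on_hcomp\<close> applies.\<close>

lemma trace_component:
  assumes t: "twisted_trace \<sigma> \<rho> t" and x: "x \<in> A e"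
  shows "t (x * a) \<in> B (e + m - (lam, \<pi>)) \<Longrightarrow> t (x * hcomp A a m) = t (x * a)"
    and "t (a * x) \<in> B (m + e - (lam, \<pi>)) \<Longrightarrow> t (hcomp A a m * x) = t (a * x)"
proof -
  note T = twisted_traceD[OF t]
  have g: "graded_group (\<lambda>d. B (e + d - (lam, \<pi>)))" "graded_group (\<lambda>d. B (d + e - (lam, \<pi>)))"
    by (rule graded_group_reindex[OF gB], simp add: inj_def)+
  show "t (x * hcomp A a m) = t (x * a)" if "t (x * a) \<in> B (e + m - (lam, \<pi>))"
    by (rule additive_on_hcomp[OF gA g(1) additive_A, of "\<lambda>a. t (x * a)"])
      (use that in \<open>simp_all add: distrib_left T(1,2) mult_A x\<close>)
  show "t (hcomp A a m * x) = t (a * x)" if "t (a * x) \<in> B (m + e - (lam, \<pi>))"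
    by (rule additive_on_hcomp[OF gA g(2) additive_A, of "\<lambda>a. t (a * x)"])
      (use that in \<open>simp_all add: distrib_right T(1,2) mult_A x\<close>)
qed

text \<open>Zero lies in every component, so \<open>trace_component\<close> applies in each degree
  \<open>d\<close>: the radical of the pairing is spanned by homogeneous elements.\<close>

lemma annihilator_graded:
  assumes t: "twisted_trace \<sigma> \<rho> t" and a: "\<And>x. t (x * a) = 0"
  shows "t (x * hcomp A a d) = 0"
proof (rule additive_eqI[of "\<lambda>x. t (x * hcomp A a d)" "\<lambda>_. 0"])
  fix e x assume x: "x \<in> A e"
  show "t (x * hcomp A a d) = 0"
    using trace_component(1)[OF t x, of a d] graded_group_zero[OF gB] a by simp
qed (simp_all add: distrib_right twisted_traceD(1)[OF t])

section \<open>The module \<open>HOM_L\<close> of the extension and explicit forms of its two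
  actions\<close>

definition homs where
  "homs = HOM_L B A (\<lambda>b x. \<beta> b * x) (shift (lam, \<pi>) B) (shift_lact (lam, \<pi>) B (*))"

abbreviation lact where "lact \<equiv> HOM_L_lact A A (\<lambda>a x. x * \<alpha> a) homs"
abbreviation ract :: "'a \<Rightarrow> ('a \<Rightarrow> 'a) \<Rightarrow> 'a \<Rightarrow> 'a" where "ract \<equiv> HOM_L_ract B A (\<lambda>b y. y * b)"

lemma shift_lact_eq: "b \<in> dsum B \<Longrightarrow> shift_lact (lam, \<pi>) B (*) b y = sg \<pi> b * y"
proof (rule additive_on_eqI[OF gB, of "\<lambda>b. shift_lact (lam, \<pi>) B (*) b y"])
  show "additive_on (dsum B) (\<lambda>b. shift_lact (lam, \<pi>) B (*) b y)"
    unfolding additive_on_def shift_lact_def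
    by (intro ballI hext_add[OF gB]) (auto simp: additive_on_def koszul_add distrib_right)
  show "additive_on (dsum B) (\<lambda>b. sg \<pi> b * y)"
    by (simp add: additive_on_def sg_add distrib_right)
  fix d b assume b: "b \<in> B d"
  have "shift_lact (lam, \<pi>) B (*) b y = koszul (\<pi> * snd d) (b * y)"
    unfolding shift_lact_def by (subst hext_homogeneous[OF gB b]) auto
  then show "shift_lact (lam, \<pi>) B (*) b y = sg \<pi> b * y"
    by (simp add: sg_homogeneous[OF BA[OF b]] koszul_mult)
qed

text \<open>The sign from the degree of \<open>f\<close> and the sign of the shifted left action
  combine into the single twist \<open>sg (snd d + \<pi>)\<close>; additivity extends the rule to
  inhomogeneous \<open>b\<close>.\<close>

lemma homs_iff:
  "f \<in> homs d \<longleftrightarrow> (\<forall>x y. f (x + y) = f x + f y) \<and> (\<forall>e. \<forall>x\<in>A e. f x \<in> B (e + d - (lam, \<pi>))) \<and>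
     (\<forall>b\<in>dsum B. \<forall>x. f (\<beta> b * x) = sg (snd d + \<pi>) b * f x)"
proof -
  let ?l = "\<forall>e. \<forall>b\<in>B e. \<forall>x. f (\<beta> b * x) = koszul (snd d * snd e) (shift_lact (lam, \<pi>) B (*) b (f x))"
  let ?r = "\<forall>b\<in>dsum B. \<forall>x. f (\<beta> b * x) = sg (snd d + \<pi>) b * f x"
  have "?l \<longleftrightarrow> ?r" if add: "\<And>x y. f (x + y) = f x + f y"
  proof -
    have *: "koszul (snd d * snd e) (shift_lact (lam, \<pi>) B (*) b y) = sg (snd d + \<pi>) b * y"
      if "b \<in> B e" for b e y
      using shift_lact_eq[OF homogeneous_total[of b B, OF that]] sg_homogeneous[OF BA[OF that]]
      by (simp add: koszul_mult koszul_koszul distrib_right)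
    have "f (\<beta> b * x) = sg (snd d + \<pi>) b * f x" if l: ?l and b: "b \<in> dsum B" for b x
      by (rule additive_on_eqI[OF gB _ _ _ b, of "\<lambda>b. f (\<beta> b * x)"])
        (use l * in \<open>auto simp: additive_on_def \<beta>_add add sg_add distrib_right\<close>)
    then show ?thesis using * homogeneous_total[of _ B] by metis
  qed
  then have "(\<forall>x y. f (x + y) = f x + f y) \<Longrightarrow> ?l = ?r" by blast
  then show ?thesis
    by (simp add: homs_def HOM_L_def shift_eq additive_on_def image_subset_iff del: split_paired_All cong: conj_cong)
qed

lemma homsD:
  assumes "f \<in> homs d"
  shows "f (x + y) = f x + f y" "x \<in> A e \<Longrightarrow> f x \<in> B (e + d - (lam, \<pi>))"
    "b \<in> dsum B \<Longrightarrow> f (\<beta> b * x) = sg (snd d + \<pi>) b * f x" "f 0 = 0" "f (koszul p x) = koszul p (f x)"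
proof -
  show add: "f (x + y) = f x + f y" for x y using assms homs_iff by blast
  show "x \<in> A e \<Longrightarrow> f x \<in> B (e + d - (lam, \<pi>))" "b \<in> dsum B \<Longrightarrow> f (\<beta> b * x) = sg (snd d + \<pi>) b * f x"
    using assms homs_iff by blast+
  show "f 0 = 0" using add[of 0 0] by simp
  show "f (koszul p x) = koszul p (f x)"
    by (rule additive_on_koszul[of UNIV]) (use add in \<open>auto simp: additive_on_def\<close>)
qed

lemma gH: "graded_group homs"
  unfolding homs_def
  by (rule graded_group_HOM_L[OF gA])
    (use gB in \<open>auto simp: shift_eq shift_lact_eq distrib_left graded_group_def
      intro: graded_group_indep_inj[OF gB, where h = "\<lambda>d. d - (lam, \<pi>)"]\<close>)

text \<open>The part of the sign that involves the argument becomes the twist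
  \<open>sg (snd i)\<close>; the part that involves only \<open>a\<close> and \<open>f\<close> stays
  in front. The two outer extensions collapse because \<open>a\<close> and \<open>f\<close> are
  homogeneous, the inner one after reduction to homogeneous arguments.\<close>

lemma lact_homogeneous:
  assumes a: "a \<in> A i" and f: "f \<in> homs j"
  shows "lact a f = (\<lambda>x. koszul (snd i * snd j) (f (sg (snd i) x * \<alpha> a)))"
proof
  fix x
  let ?F = "\<lambda>(i :: 'l \<times> bit) (a :: 'a) j f. hext A (\<lambda>k x'. koszul (snd i * snd j + snd i * snd k) (f (x' * \<alpha> a) :: 'a)) x"
  have z: "?F i a j 0 = 0" for i a j unfolding hext_def by simp
  have z': "hext homs (?F i 0) f = 0"
    by (subst hext_homogeneous[OF gH f, where F = "?F i 0", OF z]) (simp add: hext_def homsD(4)[OF f])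
  have "lact a f x = ?F i a j f"
    unfolding HOM_L_lact_def
    by (subst hext_homogeneous[OF gA a, where F = "\<lambda>i a. hext homs (?F i a) f", OF z'],
        subst hext_homogeneous[OF gH f, where F = "?F i a", OF z]) (rule refl)
  also have "\<dots> = koszul (snd i * snd j) (f (sg (snd i) x * \<alpha> a))"
  proof (rule additive_eqI[of "\<lambda>x. hext A (\<lambda>k x'. koszul (snd i * snd j + snd i * snd k) (f (x' * \<alpha> a) :: 'a)) x"
      "\<lambda>x. koszul (snd i * snd j) (f (sg (snd i) x * \<alpha> a))"])
    fix k x assume x: "x \<in> A k"
    show "hext A (\<lambda>k x'. koszul (snd i * snd j + snd i * snd k) (f (x' * \<alpha> a) :: 'a)) x =
      koszul (snd i * snd j) (f (sg (snd i) x * \<alpha> a))"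
      by (subst hext_homogeneous[OF gA x])
        (auto simp: homsD(4,5)[OF f] sg_homogeneous[OF x] koszul_mult koszul_koszul)
  next
    fix x y
    show "hext A (\<lambda>k x'. koszul (snd i * snd j + snd i * snd k) (f (x' * \<alpha> a) :: 'a)) (x + y) =
      hext A (\<lambda>k x'. koszul (snd i * snd j + snd i * snd k) (f (x' * \<alpha> a) :: 'a)) x +
      hext A (\<lambda>k x'. koszul (snd i * snd j + snd i * snd k) (f (x' * \<alpha> a) :: 'a)) y"
      by (rule hext_add[OF gA]) (auto simp: additive_on_def distrib_right homsD(1)[OF f] koszul_add)
    show "koszul (snd i * snd j) (f (sg (snd i) (x + y) * \<alpha> a)) =
      koszul (snd i * snd j) (f (sg (snd i) x * \<alpha> a)) + koszul (snd i * snd j) (f (sg (snd i) y * \<alpha> a))"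
      by (simp add: sg_add distrib_right homsD(1)[OF f] koszul_add)
  qed
  finally show "lact a f x = koszul (snd i * snd j) (f (sg (snd i) x * \<alpha> a))" .
qed

text \<open>The action is defined by nested sums over components. Additivity in the map, and in the
  scalar below, lets linearity be checked on homogeneous elements, where
  \<open>lact_homogeneous\<close> applies.\<close>

lemma lact_add_right:
  assumes f: "f \<in> dsum homs" and g: "g \<in> dsum homs"
  shows "lact a (f + g) = lact a f + lact a g"
proof
  fix x
  let ?F = "\<lambda>(i :: 'l \<times> bit) (a :: 'a) j f. hext A (\<lambda>k x'. koszul (snd i * snd j + snd i * snd k) (f (x' * \<alpha> a) :: 'a)) x"
  have "hext homs (?F i a) (f + g) = hext homs (?F i a) f + hext homs (?F i a) g" for i a
    by (rule hext_add[OF gH _ f g]) (simp add: additive_on_def hext_def koszul_add sum.distrib)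
  then show "lact a (f + g) x = (lact a f + lact a g) x"
    by (simp add: HOM_L_lact_def hext_plus)
qed

lemma lact_add_left:
  assumes f: "f \<in> dsum homs"
  shows "lact (a + b) f = lact a f + lact b f"
proof
  fix x
  let ?F = "\<lambda>(i :: 'l \<times> bit) (a :: 'a) j f. hext A (\<lambda>k x'. koszul (snd i * snd j + snd i * snd k) (f (x' * \<alpha> a) :: 'a)) x"
  have "?F i (a + b) j (hcomp homs f j) = ?F i a j (hcomp homs f j) + ?F i b j (hcomp homs f j)" for i j a b
    unfolding hext_def sum.distrib[symmetric]
    using homsD(1)[OF hcomp_props(1)[OF gH f]] by (simp add: \<alpha>_add distrib_left koszul_add)
  then have "hext homs (?F i (a + b)) f = hext homs (?F i a) f + hext homs (?F i b) f" for i a b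
    unfolding hext_def[of homs] by (simp add: sum.distrib)
  then show "lact (a + b) f x = (lact a f + lact b f) x"
    unfolding HOM_L_lact_def plus_fun_def
    by (intro hext_add[OF gA]) (auto simp: additive_on_def)
qed

text \<open>The sign involves only the degrees of \<open>b\<close> and of the argument, so for
  additive \<open>f\<close> it becomes a twist of the argument.\<close>

lemma ract_homogeneous:
  assumes b: "b \<in> B i" and f: "\<And>x y. f (x + y) = f x + f y"
  shows "ract b f = (\<lambda>x. f (sg (snd i) x) * b)"
proof
  fix x
  have f0: "f 0 = 0" using f[of 0 0] by simp
  have fk: "f (koszul p x) = koszul p (f x)" for p x
    by (rule additive_on_koszul[of UNIV]) (auto simp: additive_on_def f)
  have "ract b f x = hext A (\<lambda>k x'. koszul (snd i * snd k) (f x' * b)) x"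
    unfolding HOM_L_ract_def by (subst hext_homogeneous[OF gB b]) (auto simp: hext_def)
  also have "\<dots> = f (sg (snd i) x) * b"
  proof (rule additive_eqI[of "\<lambda>x. hext A (\<lambda>k x'. koszul (snd i * snd k) (f x' * b)) x"
      "\<lambda>x. f (sg (snd i) x) * b"])
    fix k x assume x: "x \<in> A k"
    show "hext A (\<lambda>k x'. koszul (snd i * snd k) (f x' * b)) x = f (sg (snd i) x) * b"
      by (subst hext_homogeneous[OF gA x]) (auto simp: f0 sg_homogeneous[OF x] fk koszul_mult)
  next
    fix x y
    show "hext A (\<lambda>k x'. koszul (snd i * snd k) (f x' * b)) (x + y) =
      hext A (\<lambda>k x'. koszul (snd i * snd k) (f x' * b)) x + hext A (\<lambda>k x'. koszul (snd i * snd k) (f x' * b)) y"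
      by (rule hext_add[OF gA]) (auto simp: additive_on_def distrib_right f koszul_add)
  qed (simp add: sg_add f distrib_right)
  finally show "ract b f x = f (sg (snd i) x) * b" .
qed

lemma ract_add_right: "ract b (f + g) = ract b f + ract b g"
  unfolding HOM_L_ract_def hext_def by (simp add: fun_eq_iff distrib_right koszul_add sum.distrib)

lemma ract_add_left:
  assumes "b \<in> dsum B" "c \<in> dsum B"
  shows "ract (b + c) f = ract b f + ract c f"
  unfolding HOM_L_ract_def fun_eq_iff plus_fun_apply
  by (intro allI hext_add[OF gB _ assms])
    (simp add: additive_on_def hext_def distrib_left koszul_add sum.distrib)

section \<open>The trace criterion\<close>

lemma bimodule_hom_trace_iff:
  "bimodule_hom B B A (\<lambda>b x. \<alpha>' b * x) (\<lambda>b x. x * \<beta>' b)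
     (shift (lam, \<pi>) B) (shift_lact (lam, \<pi>) B (*)) (\<lambda>b y. y * b) t \<longleftrightarrow> twisted_trace \<alpha>' \<beta>' t"
  using shift_lact_eq
  unfolding bimodule_hom_def module_hom_def twisted_trace_def additive_on_def shift_eq total image_subset_iff
  by simp blast

lemma HOM_R_mem:
  "\<phi> \<in> HOM_R B A (\<lambda>b x. x * \<beta>' b) B (\<lambda>b y. y * b) d \<longleftrightarrow>
    (\<forall>x y. \<phi> (x + y) = \<phi> x + \<phi> y) \<and> (\<forall>e. \<forall>x\<in>A e. \<phi> x \<in> B (e + d)) \<and>
    (\<forall>b\<in>dsum B. \<forall>x. \<phi> (x * \<beta>' b) = \<phi> x * b)"
  unfolding HOM_R_def mem_Collect_eq additive_on_def total image_subset_iff by blast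

lemma HOM_R_total:
  assumes "\<phi> \<in> dsum (HOM_R B A (\<lambda>b x. x * \<beta>' b) B (\<lambda>b y. y * b))"
  shows "\<phi> (x + y) = \<phi> x + \<phi> y" and "b \<in> dsum B \<Longrightarrow> \<phi> (x * \<beta>' b) = \<phi> x * b" and "\<phi> x \<in> dsum B"
proof -
  obtain D c where D: "\<And>d. d \<in> D \<Longrightarrow> c d \<in> HOM_R B A (\<lambda>b x. x * \<beta>' b) B (\<lambda>b y. y * b) d"
    "\<phi> = (\<Sum>d\<in>D. c d)"
    using assms unfolding dsum_def by auto
  have c: "c d (x + y) = c d x + c d y" "b \<in> dsum B \<Longrightarrow> c d (x * \<beta>' b) = c d x * b"
    "x \<in> A e \<Longrightarrow> c d x \<in> B (e + d)" if "d \<in> D" for d x y b e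
    using D(1)[OF that] unfolding HOM_R_mem by blast+
  show add: "\<phi> (x + y) = \<phi> x + \<phi> y" for x y
    unfolding D(2) sum_fun_apply sum.distrib[symmetric] using c(1) by (rule sum.cong[OF refl])
  show "\<phi> (x * \<beta>' b) = \<phi> x * b" if "b \<in> dsum B"
    unfolding D(2) sum_fun_apply sum_distrib_right using c(2) that by (intro sum.cong[OF refl])
  show "\<phi> x \<in> dsum B"
  proof (rule additive_on_total[OF gA gB additive_A], rule add)
    fix e x assume "x \<in> A e"
    then show "\<phi> x \<in> dsum B"
      unfolding D(2) sum_fun_apply
      by (intro total_sum_mem[OF gB]) (rule homogeneous_total, rule c(3))
  qed simp
qed

text \<open>The isomorphism sends \<open>a\<close> to \<open>a\<close> acting on \<open>t\<close>.
  The right expansion gives injectivity, since its coefficients are values of the pairing; the left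
  expansion gives surjectivity, since a map in \<open>homs\<close> is determined by its values at
  the \<open>y j\<close>.\<close>

lemma bimodule_isomorphic_homs:
  assumes t: "twisted_trace \<beta> \<alpha> t"
    and x: "\<And>j. j \<in> J \<Longrightarrow> x j \<in> A (dg j)" and y: "\<And>j. j \<in> J \<Longrightarrow> y j \<in> A ((lam, \<pi>) - dg j)"
    and right: "\<And>z. z = (\<Sum>j\<in>J. x j * \<alpha> (t (y j * z)))"
    and left: "\<And>z. z = (\<Sum>j\<in>J. \<beta> (sg \<pi> (t (z * x j))) * y j)"
  shows "bimodule_isomorphic A B A (*) (\<lambda>b x. x * b) homs lact ract"
proof -
  note T = twisted_traceD[OF t]
  \<comment> \<open>On homogeneous \<open>a\<close> this is \<open>lact a t\<close>, because
    \<open>t\<close> has degree zero.\<close>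
  define F where "F = (\<lambda>a z. hext A (\<lambda>d a'. t (sg (snd d) z * \<alpha> a')) a)"
  have F: "F a = (\<lambda>z. t (sg (snd d) z * \<alpha> a))" if "a \<in> A d" for a d
    unfolding F_def by (rule ext) (rule hext_homogeneous[OF gA that], simp add: T(5))
  have F_add: "F (a + b) = F a + F b" for a b
    unfolding F_def plus_fun_def
    by (rule ext) (rule hext_add[OF gA], auto simp: additive_on_def \<alpha>_add distrib_left T(1))
  have F_sum: "F (\<Sum>i\<in>I. c i) = (\<Sum>i\<in>I. F (c i))" for I :: "('l \<times> bit) set" and c
    by (rule additive_sum) (rule F_add)
  have F_hom: "F a \<in> homs d" if a: "a \<in> A d" for a d
    unfolding homs_iff F[OF a]
  proof (intro conjI allI ballI)
    show "t (sg (snd d) (u + v) * \<alpha> a) = t (sg (snd d) u * \<alpha> a) + t (sg (snd d) v * \<alpha> a)" for u v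
      by (simp add: sg_add distrib_right T(1))
    show "t (sg (snd d) u * \<alpha> a) \<in> B (e + d - (lam, \<pi>))" if "u \<in> A e" for u e
      by (intro T(2) mult_A sg_mem \<alpha>_mem a that)
    show "t (sg (snd d) (\<beta> b * u) * \<alpha> a) = sg (snd d + \<pi>) b * t (sg (snd d) u * \<alpha> a)"
      if b: "b \<in> dsum B" for b u
      using T(3)[OF sg_total_B[OF b], of "snd d" "sg (snd d) u * \<alpha> a"] b
      by (simp add: sg_mult \<beta>_sg[symmetric] mult.assoc sg_sg add.commute)
  qed
  have F_tot: "F a \<in> dsum homs" for a
    by (rule additive_on_total[OF gA gH additive_A], rule F_add, rule homogeneous_total, erule F_hom) simp
  have lin_l: "F (a * b) = lact a (F b)" for a b
  proof (rule additive_eqI[of "\<lambda>a. F (a * b)" "\<lambda>a. lact a (F b)"])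
    fix i a assume a: "a \<in> A i"
    show "F (a * b) = lact a (F b)"
    proof (rule additive_eqI[of "\<lambda>b. F (a * b)" "\<lambda>b. lact a (F b)"])
      fix j b assume b: "b \<in> A j"
      show "F (a * b) = lact a (F b)"
      proof
        fix z
        have *: "t (koszul p u) = koszul p (t u)" for p u
          by (rule additive_on_koszul[of UNIV]) (auto simp: additive_on_def T(1))
        have "lact a (F b) z = koszul (snd i * snd j) (t (sg (snd j) (sg (snd i) z * \<alpha> a) * \<alpha> b))"
          by (simp only: lact_homogeneous[OF a F_hom[OF b]]) (simp only: F[OF b])
        \<comment> \<open>Moving the twist past \<open>\<alpha> a\<close> costs exactly the sign in
          front of the left action, so the two cancel.\<close>
        also have "sg (snd j) (sg (snd i) z * \<alpha> a) = koszul (snd i * snd j) (sg (snd i + snd j) z * \<alpha> a)"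
          by (simp add: sg_mult sg_sg sg_homogeneous[OF \<alpha>_mem[OF a]] koszul_mult add.commute mult.commute)
        finally show "F (a * b) z = lact a (F b) z"
          unfolding F[OF mult_A[OF a b]]
          by (simp add: koszul_mult * koszul_koszul \<alpha>_mult mult.assoc)
      qed
    qed (auto simp: distrib_left F_add lact_add_right F_tot)
  qed (auto simp: distrib_right F_add lact_add_left F_tot)
  have lin_r: "F (a * b) = ract b (F a)" if b: "b \<in> dsum B" for a b
  proof (rule additive_on_eqI[OF gB _ _ _ b, of "\<lambda>b. F (a * b)" "\<lambda>b. ract b (F a)"])
    fix i b assume b: "b \<in> B i"
    show "F (a * b) = ract b (F a)"
    proof (rule additive_eqI[of "\<lambda>a. F (a * b)" "\<lambda>a. ract b (F a)"])
      fix j a assume a: "a \<in> A j"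
      show "F (a * b) = ract b (F a)"
        using T(4)[OF homogeneous_total[of b B, OF b]]
        by (simp only: ract_homogeneous[OF b homsD(1)[OF F_hom[OF a]]] F[OF mult_A[OF a BA[OF b]]])
          (simp add: F[OF a] sg_sg \<alpha>_mult mult.assoc[symmetric])
    qed (auto simp: distrib_right F_add ract_add_right)
  qed (auto simp: additive_on_def distrib_left F_add ract_add_left)
  have "inj F"
  proof (rule injI)
    fix a b assume "F a = F b"
    then have "F (a - b) = 0" using F_add[of "a - b" b] by simp
    \<comment> \<open>The explicit form of \<open>F\<close> holds on homogeneous elements, so
      components are treated one by one; each is killed by \<open>F\<close> because zero has every
      degree.\<close>
    have "hcomp A (a - b) d = 0" for d
    proof -
      have "F (hcomp A (a - b) d) = F (a - b)"
        by (rule additive_on_hcomp[OF gA gH additive_A], rule F_add, erule F_hom, simp)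
          (simp only: \<open>F (a - b) = 0\<close> graded_group_zero[OF gH])
      then have "t (sg (snd d) z * \<alpha> (hcomp A (a - b) d)) = 0" for z
        unfolding \<open>F (a - b) = 0\<close> F[OF hcomp_props(1)[OF gA, unfolded total, OF UNIV_I]] by (simp add: fun_eq_iff)
      from this[of "sg (snd d) _"] have "t (z * \<alpha> (hcomp A (a - b) d)) = 0" for z by simp
      then have "\<alpha> (hcomp A (a - b) d) = 0" using right[of "\<alpha> (hcomp A (a - b) d)"] by simp
      then show ?thesis by (metis \<alpha>_inv(2) \<alpha>'_0)
    qed
    then show "a = b" using hcomp_props(3)[OF gA, of "a - b"] by simp
  qed
  have surj: "\<exists>a. F a = f" if f: "f \<in> homs d" for f d
  proof -
    \<comment> \<open>Untwisting the argument removes the sign due to the degree of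
      \<open>f\<close>; \<open>g\<close> then has the same left linearity as
      \<open>t\<close>.\<close>
    define g where "g = (\<lambda>z. f (sg (snd d) z))"
    have g_add: "g (u + v) = g u + g v" for u v
      unfolding g_def by (simp add: sg_add homsD(1)[OF f])
    have g_lin: "g (\<beta> b * u) = sg \<pi> b * g u" if b: "b \<in> dsum B" for b u
      using homsD(3)[OF f sg_total_B[OF b]] b
      unfolding g_def by (simp add: sg_mult \<beta>_sg[symmetric] sg_sg add.commute add.left_commute)
    have gy: "g (y j) \<in> B (d - dg j)" if "j \<in> J" for j
      using homsD(2)[OF f sg_mem[OF y[OF that]]] unfolding g_def by (simp add: algebra_simps)
    \<comment> \<open>Applying \<open>g\<close> to the left expansion of \<open>z\<close> gives the
      sum of \<open>t (z * x j) * g (y j)\<close>. Right linearity of \<open>t\<close> moves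
      \<open>g (y j)\<close> inside as \<open>\<alpha> (g (y j))\<close>, which dictates
      \<open>\<alpha> a\<close>.\<close>
    define a where "a = \<alpha>' (\<Sum>j\<in>J. x j * \<alpha> (g (y j)))"
    have "x j * \<alpha> (g (y j)) \<in> A d" if "j \<in> J" for j
      using mult_A[OF x[OF that] \<alpha>_mem[OF BA[OF gy[OF that]]]] by simp
    then have a: "a \<in> A d" unfolding a_def by (intro \<alpha>'_mem graded_group_sum[OF gA])
    have "t (z * \<alpha> a) = g z" for z
    proof -
      have "g z = (\<Sum>j\<in>J. g (\<beta> (sg \<pi> (t (z * x j))) * y j))"
        by (subst left[of z]) (rule additive_sum, rule g_add)
      also have "\<dots> = (\<Sum>j\<in>J. t (z * x j * \<alpha> (g (y j))))"
        by (intro sum.cong) (simp_all add: g_lin sg_total_B T(6) T(4)[OF homogeneous_total[of _ B, OF gy]])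
      also have "\<dots> = t (z * \<alpha> a)" by (simp add: a_def sum_distrib_left T(7) mult.assoc)
      finally show ?thesis ..
    qed
    then have "F a = f" unfolding F[OF a] g_def by simp
    then show ?thesis ..
  qed
  have "dsum homs \<subseteq> range F"
  proof
    fix f assume "f \<in> dsum homs"
    then obtain D c where D: "\<And>d. d \<in> D \<Longrightarrow> c d \<in> homs d" "f = (\<Sum>d\<in>D. c d)"
      unfolding dsum_def by auto
    have "\<forall>d\<in>D. \<exists>a. F a = c d" using surj[OF D(1)] by blast
    from bchoice[OF this] obtain a where "\<forall>d\<in>D. F (a d) = c d" by blast
    then have "F (\<Sum>d\<in>D. a d) = f" unfolding D(2) F_sum by simp
    then show "f \<in> range F" by blast
  qed
  then have "bij_betw F (dsum A) (dsum homs)" using \<open>inj F\<close> F_tot unfolding bij_betw_def by auto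
  moreover have "bimodule_hom A B A (*) (\<lambda>b x. x * b) homs lact ract F"
    unfolding bimodule_hom_def module_hom_def using lin_l lin_r F_hom F_add
    by (auto simp: additive_on_def simp del: split_paired_All)
  ultimately show ?thesis unfolding bimodule_isomorphic_def by blast
qed

lemma frobenius_extension_unfold:
  "frobenius_extension A B \<alpha> \<beta> (- lam, \<pi>) \<longleftrightarrow> finitely_generated B A (*) \<and> left_projective B A (*) \<and>
     bimodule_isomorphic A B A (*) (\<lambda>b x. x * b) homs lact ract"
  unfolding frobenius_extension_def homs_def by (simp add: Let_def)

text \<open>The coordinates of a right dual basis are represented through the trace by elements
  \<open>q j\<close>, which yields a right expansion and, by nondegeneracy, a left one. Carried over
  by \<open>\<alpha>\<close>, the left one is a left dual basis, and the two together give the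
  isomorphism.\<close>

lemma frobenius_if_trace:
  assumes t: "twisted_trace \<alpha>' \<beta>' t" and nondeg: "\<And>a. (\<And>x. t (a * x) = 0) \<Longrightarrow> a = 0"
    and repr: "\<And>\<phi>. \<phi> \<in> dsum (HOM_R B A (\<lambda>b x. x * \<beta>' b) B (\<lambda>b y. y * b)) \<Longrightarrow> \<exists>a. \<phi> = t \<circ> (\<lambda>x. a * x)"
    and fg: "finitely_generated B A (\<lambda>b x. x * b)" and proj: "right_projective B A (\<lambda>b x. x * b)"
  shows "frobenius_extension A B \<alpha> \<beta> (- lam, \<pi>)"
proof -
  note T = twisted_traceD[OF t]
  obtain J :: "('a \<times> ('l \<times> bit)) set" and e f where J: "finite J" and e: "\<And>j. j \<in> J \<Longrightarrow> e j \<in> A (snd j)"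
    and f: "\<And>j. j \<in> J \<Longrightarrow> additive_on (dsum A) (f j)" "\<And>j d. j \<in> J \<Longrightarrow> f j ` A d \<subseteq> B (d - snd j)"
      "\<And>j b u. j \<in> J \<Longrightarrow> b \<in> dsum B \<Longrightarrow> u \<in> dsum A \<Longrightarrow> f j (u * b) = f j u * b"
      "\<And>u. u \<in> dsum A \<Longrightarrow> u = (\<Sum>j\<in>J. e j * f j u)"
    by (rule homogeneous_dual_basis[OF disjI2[OF refl] rB right_module fg proj]) (rule that)
  have f_add: "f j (u + v) = f j u + f j v" and f_deg: "u \<in> A d \<Longrightarrow> f j u \<in> B (d - snd j)"
    and f_lin: "b \<in> dsum B \<Longrightarrow> f j (u * b) = f j u * b" if "j \<in> J" for j u v b d
    using f(1-3)[OF that] unfolding additive_on_def by (simp, blast, simp)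
  have dual: "u = (\<Sum>j\<in>J. e j * f j u)" for u by (rule f(4)) simp
  have f_tot: "f j u \<in> dsum B" if "j \<in> J" for j u
    by (rule additive_on_total[OF gA gB additive_A], rule f_add[OF that], rule homogeneous_total,
        erule f_deg[OF that]) simp
  have "\<exists>q\<in>A ((lam, \<pi>) - snd j). \<forall>x. t (q * x) = \<beta> (f j x)" if j: "j \<in> J" for j
  proof -
    \<comment> \<open>\<open>f j\<close> is linear for the plain right action; composing with
      \<open>\<beta>\<close> makes it linear for the action twisted by
      \<open>\<beta>'\<close>.\<close>
    have "(\<lambda>x. \<beta> (f j x)) \<in> HOM_R B A (\<lambda>b x. x * \<beta>' b) B (\<lambda>b y. y * b) (- snd j)"
      unfolding HOM_R_mem diff_conv_add_uminus[symmetric]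
    proof (intro conjI allI ballI)
      show "\<beta> (f j x) \<in> B (d - snd j)" if "x \<in> A d" for d x by (rule \<beta>_mem[OF f_deg[OF j that]])
    qed (simp_all add: j f_add f_lin f_tot \<beta>_add \<beta>_mult \<beta>'_total)
    from repr[OF homogeneous_total, OF this]
    obtain a where "(\<lambda>x. \<beta> (f j x)) = t \<circ> (\<lambda>x. a * x)" by blast
    then have a: "t (a * x) = \<beta> (f j x)" for x by (simp add: fun_eq_iff)
    \<comment> \<open>The representing element need not be homogeneous. The functional has degree
      \<open>- snd j\<close> and \<open>t\<close> has degree \<open>- (lam, \<pi>)\<close>, so only
      this component contributes.\<close>
    let ?q = "hcomp A a ((lam, \<pi>) - snd j)"
    have "t (?q * x) = \<beta> (f j x)" for x
    proof (rule additive_eqI[of "\<lambda>x. t (?q * x)" "\<lambda>x. \<beta> (f j x)"])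
      fix d x assume x: "x \<in> A d"
      have "t (a * x) \<in> B (((lam, \<pi>) - snd j) + d - (lam, \<pi>))"
        using \<beta>_mem[OF f_deg[OF j x]] unfolding a by (simp add: algebra_simps)
      from trace_component(2)[OF t x this] show "t (?q * x) = \<beta> (f j x)" unfolding a .
    qed (auto simp: distrib_left T(1) f_add j \<beta>_add f_tot)
    then show ?thesis
      by (intro bexI[of _ ?q]) (simp_all add: hcomp_props(1)[OF gA])
  qed
  then obtain q where q: "\<And>j. j \<in> J \<Longrightarrow> q j \<in> A ((lam, \<pi>) - snd j)"
    "\<And>j x. j \<in> J \<Longrightarrow> t (q j * x) = \<beta> (f j x)" by metis
  have right: "z = (\<Sum>j\<in>J. e j * \<beta>' (t (q j * z)))" for z
    using dual[of z] by (simp add: q(2) f_tot)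
  have left: "z = (\<Sum>j\<in>J. \<alpha>' (sg \<pi> (t (z * e j))) * q j)" for z
    by (rule left_expansion[OF t nondeg right])

  \<comment> \<open>The left expansion has coefficients in the image of \<open>\<alpha>'\<close>.
    Expanding \<open>\<alpha>' z\<close> and applying \<open>\<alpha>\<close> makes them plain
    elements of \<open>B\<close>, linear in \<open>z\<close>.\<close>
  define g where "g = (\<lambda>j z. sg \<pi> (t (\<alpha>' z * e j)))"
  have g_dual: "z = (\<Sum>j\<in>J. g j z * \<alpha> (q j))" for z
  proof -
    have "\<alpha> (\<alpha>' z) = (\<Sum>j\<in>J. \<alpha> (\<alpha>' (sg \<pi> (t (\<alpha>' z * e j))) * q j))"
      by (subst left) (rule additive_sum, rule \<alpha>_add)
    then show ?thesis by (simp add: g_def \<alpha>_mult)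
  qed
  have g_tot: "g j z \<in> dsum B" for j z unfolding g_def by (rule sg_total_B[OF T(6)])
  have "finitely_generated B A (*)"
    by (rule dual_basis_finitely_generated[OF rB left_module J, of "\<lambda>j. \<alpha> (q j)" g])
      (use g_dual g_tot in auto)
  moreover have "left_projective B A (*)"
  proof (rule dual_basis_projective[OF rB left_module, of J "\<lambda>j. \<alpha> (q j)" "\<lambda>j. (lam, \<pi>) - snd j" g])
    fix j assume j: "j \<in> J"
    show "\<alpha> (q j) \<in> A ((lam, \<pi>) - snd j)" by (rule \<alpha>_mem[OF q(1)[OF j]])
    show "additive_on (dsum A) (g j)"
      by (rule additive_A) (simp add: g_def \<alpha>'_add distrib_right T(1) sg_add)
    have "g j z \<in> B (d + snd j - (lam, \<pi>))" if "z \<in> A d" for z d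
      unfolding g_def by (intro sg_mem_B T(2) mult_A \<alpha>'_mem that e j)
    then show "g j ` A d \<subseteq> B (d - ((lam, \<pi>) - snd j))" for d
      unfolding diff_diff_eq2 by blast
    show "g j (b * z) = b * g j z" if "b \<in> dsum B" for b z
      by (simp add: g_def \<alpha>'_mult mult.assoc T(3)[OF that] sg_mult)
  qed (use g_dual in auto)
  moreover have "bimodule_isomorphic A B A (*) (\<lambda>b x. x * b) homs lact ract"
  proof (rule bimodule_isomorphic_homs[OF trace_to_left[OF t], of J "\<lambda>j. \<alpha> (e j)" snd "\<lambda>j. \<alpha> (q j)"])
    fix z
    have "\<alpha> (\<alpha>' z) = (\<Sum>j\<in>J. \<alpha> (e j * \<beta>' (t (q j * \<alpha>' z))))"
      by (subst right) (rule additive_sum, rule \<alpha>_add)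
    then show "z = (\<Sum>j\<in>J. \<alpha> (e j) * \<alpha> (\<beta>' (t (\<alpha>' (\<alpha> (q j) * z)))))"
      by (simp add: \<alpha>_mult \<alpha>'_mult)
    show "z = (\<Sum>j\<in>J. \<beta> (sg \<pi> (\<beta>' (t (\<alpha>' (z * \<alpha> (e j)))))) * \<alpha> (q j))"
      using g_dual[of z] by (simp add: g_def \<alpha>'_mult \<beta>_sg T(6) \<beta>'_total)
  qed (use e q(1) in \<open>auto intro: \<alpha>_mem\<close>)
  ultimately show ?thesis unfolding frobenius_extension_unfold by blast
qed

text \<open>The trace is \<open>F 1\<close>, transported to the right. Injectivity of
  \<open>F\<close> gives nondegeneracy, and surjectivity represents the coordinates of a left dual
  basis, hence a left expansion. The resulting right expansion represents every functional in
  \<open>HOM_R\<close>.\<close>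

lemma trace_if_frobenius:
  assumes "frobenius_extension A B \<alpha> \<beta> (- lam, \<pi>)"
  shows "\<exists>tr. twisted_trace \<alpha>' \<beta>' tr \<and> (\<forall>a. (\<forall>x. tr (a * x) = 0) \<longrightarrow> a = 0) \<and>
    (\<forall>\<phi>\<in>dsum (HOM_R B A (\<lambda>b x. x * \<beta>' b) B (\<lambda>b y. y * b)). \<exists>a. \<phi> = tr \<circ> (\<lambda>x. a * x))"
proof -
  obtain F where fg: "finitely_generated B A (*)" and proj: "left_projective B A (*)"
    and "bimodule_hom A B A (*) (\<lambda>b x. x * b) homs lact ract F" and bij: "bij_betw F (dsum A) (dsum homs)"
    using assms unfolding frobenius_extension_unfold bimodule_isomorphic_def by blast
  then have F_add: "F (a + b) = F a + F b" and F_hom: "a \<in> A d \<Longrightarrow> F a \<in> homs d"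
    and F_l: "F (a * b) = lact a (F b)" and F_r: "c \<in> dsum B \<Longrightarrow> F (a * c) = ract c (F a)" for a b c d
    unfolding bimodule_hom_def module_hom_def additive_on_def image_subset_iff total by blast+
  define t where "t = F 1"
  have th: "t \<in> homs 0" unfolding t_def by (rule F_hom[OF one])
  note t = homsD[OF th]
  have F: "F a = (\<lambda>z. t (sg (snd d) z * \<alpha> a))" if "a \<in> A d" for a d
    using F_l[of a 1] lact_homogeneous[OF that th] unfolding t_def by simp
  \<comment> \<open>For \<open>b\<close> in \<open>B\<close>, \<open>F b\<close> is both
    \<open>b\<close> acting on \<open>t\<close> from the left and \<open>t\<close> acted on by
    \<open>b\<close> from the right; both carry the same twist of the argument, which is undone by
    evaluating at \<open>sg (snd i) z\<close>.\<close>
  have t_r: "t (z * \<alpha> b) = t z * b" if b: "b \<in> dsum B" for z b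
  proof (rule additive_on_eqI[OF gB _ _ _ b, of "\<lambda>b. t (z * \<alpha> b)" "\<lambda>b. t z * b"])
    fix i b assume b: "b \<in> B i"
    have "F b = ract b t" using F_r[OF homogeneous_total[of b B, OF b], of 1] unfolding t_def by simp
    then have "t (sg (snd i) (sg (snd i) z) * \<alpha> b) = t (sg (snd i) (sg (snd i) z)) * b"
      unfolding ract_homogeneous[OF b t(1)] F[OF BA[OF b]] by metis
    then show "t (z * \<alpha> b) = t z * b" by simp
  qed (auto simp: additive_on_def \<alpha>_add distrib_left t(1))
  have tt: "twisted_trace \<beta> \<alpha> t"
    unfolding twisted_trace_def using t t_r by (auto simp del: split_paired_All)
  note T = twisted_traceD[OF tt]
  have F_0: "F 0 = 0" using F_add[of 0 0] by simp
  \<comment> \<open>The components of \<open>a\<close> also annihilate the pairing, and for a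
    homogeneous element this says that \<open>F\<close> kills its image under
    \<open>\<alpha>'\<close>.\<close>
  have nondeg: "a = 0" if a: "\<And>x. t (x * a) = 0" for a
  proof -
    have "hcomp A a d = 0" for d
    proof -
      have d: "hcomp A a d \<in> A d" using hcomp_props(1)[OF gA] by simp
      have "F (\<alpha>' (hcomp A a d)) = F 0"
        using annihilator_graded[OF tt a] unfolding F[OF \<alpha>'_mem[OF d]] F_0 by (simp add: fun_eq_iff)
      then have "\<alpha>' (hcomp A a d) = 0" using bij unfolding bij_betw_def inj_on_def by simp
      then show ?thesis by (metis \<alpha>_inv(1) \<alpha>_0)
    qed
    then show ?thesis using hcomp_props(3)[OF gA, of a] by simp
  qed

  obtain J :: "('a \<times> ('l \<times> bit)) set" and e f where J: "finite J" and e: "\<And>j. j \<in> J \<Longrightarrow> e j \<in> A (snd j)"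
    and f: "\<And>j. j \<in> J \<Longrightarrow> additive_on (dsum A) (f j)" "\<And>j d. j \<in> J \<Longrightarrow> f j ` A d \<subseteq> B (d - snd j)"
      "\<And>j b u. j \<in> J \<Longrightarrow> b \<in> dsum B \<Longrightarrow> u \<in> dsum A \<Longrightarrow> f j (b * u) = b * f j u"
      "\<And>u. u \<in> dsum A \<Longrightarrow> u = (\<Sum>j\<in>J. f j u * e j)"
    by (rule homogeneous_dual_basis[OF disjI1[OF refl] rB left_module fg proj]) (rule that)
  have f_add: "f j (u + v) = f j u + f j v" and f_deg: "u \<in> A d \<Longrightarrow> f j u \<in> B (d - snd j)"
    and f_lin: "b \<in> dsum B \<Longrightarrow> f j (b * u) = b * f j u" if "j \<in> J" for j u v b d
    using f(1-3)[OF that] unfolding additive_on_def by (simp, blast, simp)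
  have dual: "u = (\<Sum>j\<in>J. f j u * e j)" for u by (rule f(4)) simp
  have f_tot: "f j u \<in> dsum B" if "j \<in> J" for j u
    by (rule additive_on_total[OF gA gB additive_A], rule f_add[OF that], rule homogeneous_total,
        erule f_deg[OF that]) simp
  have "\<exists>a. \<forall>z. \<beta> (sg \<pi> (t (z * a))) = sg \<pi> (f j (sg \<pi> z))" if j: "j \<in> J" for j
  proof -
    let ?d = "(lam, \<pi>) - snd j"
    \<comment> \<open>\<open>\<beta>'\<close> turns plain linearity of \<open>f j\<close> into
      linearity twisted by \<open>\<beta>\<close>, and the twist of the argument supplies the sign
      demanded by \<open>homs_iff\<close> in degree \<open>?d\<close>.\<close>
    let ?h = "\<lambda>z. \<beta>' (f j (sg (snd ?d + \<pi>) z))"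
    have h: "?h \<in> homs ?d"
      unfolding homs_iff
    proof (intro conjI allI ballI)
      show "?h (u + v) = ?h u + ?h v" for u v
        by (simp add: sg_add f_add[OF j] \<beta>'_add f_tot[OF j])
      show "?h u \<in> B (e + ?d - (lam, \<pi>))" if "u \<in> A e" for u e
        using \<beta>'_mem[OF f_deg[OF j sg_mem[OF that]]] by (simp add: algebra_simps)
      show "?h (\<beta> b * u) = sg (snd ?d + \<pi>) b * ?h u" if b: "b \<in> dsum B" for b u
        using b by (simp add: sg_mult f_lin[OF j] \<beta>'_mult f_tot[OF j] sg_total_B \<beta>_total \<beta>'_sg)
    qed
    then obtain a where a: "F a = ?h"
      using bij homogeneous_total[of ?h homs] unfolding bij_betw_def by (metis imageE)
    let ?a = "hcomp A a ?d"
    have "F ?a = ?h"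
      unfolding a[symmetric]
      by (rule additive_on_hcomp[OF gA gH additive_A]) (use F_add F_hom h a in auto)
    then have *: "t (sg (snd ?d) u * \<alpha> ?a) = ?h u" for u
      unfolding F[OF hcomp_props(1)[OF gA, unfolded total, OF UNIV_I]] by (simp add: fun_eq_iff)
    have "t (z * \<alpha> ?a) = \<beta>' (f j (sg \<pi> z))" for z
      using *[of "sg (snd ?d) z"] by (simp add: sg_sg add.commute add.left_commute)
    then show ?thesis
      using j by (intro exI[of _ "\<alpha> ?a"]) (simp add: \<beta>_sg \<beta>'_total f_tot)
  qed
  then obtain x where x: "\<And>j z. j \<in> J \<Longrightarrow> \<beta> (sg \<pi> (t (z * x j))) = sg \<pi> (f j (sg \<pi> z))" by metis
  \<comment> \<open>The coefficients just found are those of \<open>sg \<pi> z\<close>, twisted by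
    \<open>sg \<pi>\<close>. Twisting the dual basis expansion of \<open>sg \<pi> z\<close>
    therefore also twists the \<open>e j\<close>.\<close>
  define y where "y = (\<lambda>j. sg \<pi> (e j))"
  have left: "z = (\<Sum>j\<in>J. \<beta> (sg \<pi> (t (z * x j))) * y j)" for z
  proof -
    have "sg \<pi> (sg \<pi> z) = (\<Sum>j\<in>J. sg \<pi> (f j (sg \<pi> z) * e j))"
      by (subst dual) (rule sg_sum)
    then show ?thesis by (simp add: x y_def sg_mult)
  qed
  have right: "z = (\<Sum>j\<in>J. x j * \<alpha> (t (y j * z)))" for z
    by (rule right_expansion[OF tt nondeg left])

  define tr where "tr = (\<lambda>x. \<beta> (t (\<alpha> x)))"
  have tr: "twisted_trace \<alpha>' \<beta>' tr" unfolding tr_def by (rule trace_to_right[OF tt])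
  note TR = twisted_traceD[OF tr]
  show ?thesis
  proof (intro exI[of _ tr] conjI allI ballI impI tr)
    fix a assume a: "\<forall>x. tr (a * x) = 0"
    have "t (\<alpha> a * z) = 0" for z
    proof -
      have "\<beta>' (tr (a * \<alpha>' z)) = t (\<alpha> a * z)" by (simp add: tr_def \<alpha>_mult T(6))
      then show ?thesis using a by simp
    qed
    \<comment> \<open>The coefficients of the left expansion of \<open>\<alpha> a\<close> come from
      the values \<open>t (\<alpha> a * x j)\<close>, which all vanish.\<close>
    then have "\<alpha> a = 0" using left[of "\<alpha> a"] by simp
    then show "a = 0" by (metis \<alpha>_inv(2) \<alpha>'_0)
  next
    fix \<phi> assume \<phi>: "\<phi> \<in> dsum (HOM_R B A (\<lambda>b x. x * \<beta>' b) B (\<lambda>b y. y * b))"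
    note P = HOM_R_total[OF \<phi>]
    \<comment> \<open>Applying \<open>\<phi>\<close> to the right expansion, carried over by
      \<open>\<alpha>'\<close>, gives the sum of
      \<open>\<phi> (\<alpha>' (x j)) * tr (\<alpha>' (y j) * z)\<close>. Left linearity of
      \<open>tr\<close> moves the first factor inside; its \<open>sg \<pi>\<close> cancels the sign
      this produces.\<close>
    let ?a = "\<Sum>j\<in>J. \<alpha>' (sg \<pi> (\<phi> (\<alpha>' (x j)))) * \<alpha>' (y j)"
    have "\<phi> z = tr (?a * z)" for z
    proof -
      have "\<alpha>' (\<alpha> z) = (\<Sum>j\<in>J. \<alpha>' (x j * \<alpha> (t (y j * \<alpha> z))))"
        by (subst right) (rule additive_sum, rule \<alpha>'_add)
      then have "z = (\<Sum>j\<in>J. \<alpha>' (x j) * \<beta>' (tr (\<alpha>' (y j) * z)))"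
        by (simp add: \<alpha>'_mult \<alpha>_mult tr_def T(6))
      then have "\<phi> z = \<phi> (\<Sum>j\<in>J. \<alpha>' (x j) * \<beta>' (tr (\<alpha>' (y j) * z)))" by (rule arg_cong)
      also have "\<dots> = (\<Sum>j\<in>J. \<phi> (\<alpha>' (x j) * \<beta>' (tr (\<alpha>' (y j) * z))))"
        by (rule additive_sum) (rule P(1))
      also have "\<dots> = (\<Sum>j\<in>J. tr (\<alpha>' (sg \<pi> (\<phi> (\<alpha>' (x j)))) * (\<alpha>' (y j) * z)))"
        by (simp add: P(2)[OF TR(6)] TR(3)[OF sg_total_B[OF P(3)]])
      also have "\<dots> = tr (?a * z)" by (simp add: sum_distrib_right TR(7) mult.assoc)
      finally show ?thesis .
    qed
    then show "\<exists>a. \<phi> = tr \<circ> (\<lambda>x. a * x)" unfolding fun_eq_iff comp_def by blast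
  qed
qed

end

theorem corollary4p4:
  fixes A B :: "'l::ab_group_add \<times> bit \<Rightarrow> 'a::{ring,monoid_mult} set"
    and \<alpha> \<beta> :: "'a \<Rightarrow> 'a" and lam :: 'l and \<pi> :: bit
  assumes "graded_superring A" and "graded_subring B A"
    and "graded_automorphism A \<alpha>" and "graded_automorphism B \<beta>"
    and "finitely_generated B A (\<lambda>b x. x * b)" and "right_projective B A (\<lambda>b x. x * b)"
  shows "frobenius_extension A B \<alpha> \<beta> (- lam, \<pi>) \<longleftrightarrow>
    (\<exists>tr :: 'a \<Rightarrow> 'a.
       bimodule_hom B B
         A (\<lambda>b x. aut_inv A \<alpha> b * x) (\<lambda>b x. x * aut_inv B \<beta> b)
         (shift (lam, \<pi>) B) (shift_lact (lam, \<pi>) B (*)) (\<lambda>b y. y * b) tr \<and>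
       (\<forall>a. (\<forall>x. tr (a * x) = 0) \<longrightarrow> a = 0) \<and>
       (\<forall>\<phi> \<in> dsum (HOM_R B A (\<lambda>b x. x * aut_inv B \<beta> b) B (\<lambda>b y. y * b)).
          \<exists>a. \<phi> = tr \<circ> (\<lambda>x. a * x)))"
proof -
  interpret twisted_extension A B \<alpha> \<beta> lam \<pi>
    by unfold_locales (rule assms)+
  show ?thesis
    unfolding bimodule_hom_trace_iff
  proof
    assume "frobenius_extension A B \<alpha> \<beta> (- lam, \<pi>)"
    then show "\<exists>tr. twisted_trace \<alpha>' \<beta>' tr \<and> (\<forall>a. (\<forall>x. tr (a * x) = 0) \<longrightarrow> a = 0) \<and>
      (\<forall>\<phi>\<in>dsum (HOM_R B A (\<lambda>b x. x * \<beta>' b) B (\<lambda>b y. y * b)). \<exists>a. \<phi> = tr \<circ> (\<lambda>x. a * x))"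
      by (rule trace_if_frobenius)
  next
    assume "\<exists>tr. twisted_trace \<alpha>' \<beta>' tr \<and> (\<forall>a. (\<forall>x. tr (a * x) = 0) \<longrightarrow> a = 0) \<and>
      (\<forall>\<phi>\<in>dsum (HOM_R B A (\<lambda>b x. x * \<beta>' b) B (\<lambda>b y. y * b)). \<exists>a. \<phi> = tr \<circ> (\<lambda>x. a * x))"
    then show "frobenius_extension A B \<alpha> \<beta> (- lam, \<pi>)"
      using frobenius_if_trace assms(5,6) by blast
  qed
qed

end
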